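(* Let $\lambda$ be an uncountable cardinal and assume (i) $\mu^{\omega}=\mu^+$ for every cardinal $\mu<\lambda$ with $\operatorname{cf}(\mu)=\omega$, and (ii) whenever $\omega<\mu<\lambda$ with $\operatorname{cf}(\mu)=\omega$, $\diamondsuit(S)$ holds for every stationary set $S\subseteq E^{\mu^+}_{\omega_1}$. Then $\chi(\lambda,\omega_1,\omega)\le\omega_1$ implies that every $(\lambda,\omega_1,\omega)$-system is essentially disjoint.
   Context: $E^{\mu^+}_{\omega_1}=\{\alpha<\mu^+:\operatorname{cf}(\alpha)=\omega_1\}$; $\diamondsuit(S)$ is Jensen's diamond principle on $S$. A $(\lambda,\kappa,\mu)$-system is a family $\mathcal A$ with $|\mathcal A|=\lambda$, $|A|=\kappa$ for all $A\in\mathcal A$, and $|A\cap A'|<\mu$ for distinct members. Such a family is essentially disjoint if for each $A\in\mathcal A$ there is $F(A)\subseteq A$ with $|F(A)|<\kappa$ such that the sets $A\setminus F(A)$ ($A\in\mathcal A$) are pairwise disjoint. For a family $\mathcal A$ with members of at least two elements, $\chi(\mathcal A)$ is the least cardinal $\rho$ admitting $f:\bigcup\mathcal A\to\rho$ taking at least two values on every $A\in\mathcal A$, and $\chi(\lambda,\kappa,\mu)$ is the supremum of $\chi(\mathcal A)$ over all $(\lambda,\kappa,\mu)$-systems. *)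

theory Defs
  imports Main
begin

(* Cardinals are represented in the style of HOL's BNF cardinal library:
   a cardinal is (the isomorphism class of) a cardinal well-order;
   card_of A is the cardinal of A, natLeq is omega, cardSuc r is r^+. *)

abbreviation omega1 :: "nat set rel" where
  "omega1 \<equiv> cardSuc natLeq"

definition cofinal_in :: "'a rel \<Rightarrow> 'a set \<Rightarrow> bool" where
  "cofinal_in r K \<longleftrightarrow> K \<subseteq> Field r \<and> (\<forall>a\<in>Field r. \<exists>b\<in>K. (a, b) \<in> r)"

definition has_cof :: "'a rel \<Rightarrow> 'b rel \<Rightarrow> bool" where
  "has_cof r kappa \<longleftrightarrow>
     (\<exists>K. cofinal_in r K \<and> ordIso2 (card_of K) kappa) \<and>
     (\<forall>K. cofinal_in r K \<longrightarrow> ordLeq3 kappa (card_of K))"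

(* cofinality of the ordinal alpha (an element of the well-order W),
   i.e. of the initial segment of W strictly below alpha *)
definition ord_cof :: "'a rel \<Rightarrow> 'a \<Rightarrow> 'b rel \<Rightarrow> bool" where
  "ord_cof W alpha kappa \<longleftrightarrow> has_cof (Restr W (underS W alpha)) kappa"

definition E_omega1 :: "'a rel \<Rightarrow> 'a set" where
  "E_omega1 W = {alpha \<in> Field W. ord_cof W alpha omega1}"

definition club :: "'a rel \<Rightarrow> 'a set \<Rightarrow> bool" where
  "club W C \<longleftrightarrow> C \<subseteq> Field W \<and>
     (\<forall>a\<in>Field W. \<exists>c\<in>C. (a, c) \<in> W \<and> a \<noteq> c) \<and>
     (\<forall>beta\<in>Field W.
        (underS W beta \<noteq> {} \<and>
         (\<forall>a\<in>underS W beta. \<exists>c\<in>C \<inter> underS W beta. (a, c) \<in> W \<and> a \<noteq> c))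
        \<longrightarrow> beta \<in> C)"

definition stationary :: "'a rel \<Rightarrow> 'a set \<Rightarrow> bool" where
  "stationary W S \<longleftrightarrow> S \<subseteq> Field W \<and> (\<forall>C. club W C \<longrightarrow> S \<inter> C \<noteq> {})"

definition diamond :: "'a rel \<Rightarrow> 'a set \<Rightarrow> bool" where
  "diamond W S \<longleftrightarrow>
     (\<exists>A. (\<forall>alpha\<in>S. A alpha \<subseteq> underS W alpha) \<and>
          (\<forall>X. X \<subseteq> Field W \<longrightarrow> stationary W {alpha \<in> S. X \<inter> underS W alpha = A alpha}))"

definition is_system :: "'b set set \<Rightarrow> 'l rel \<Rightarrow> 'k rel \<Rightarrow> 'm rel \<Rightarrow> bool" where
  "is_system \<A> lam kappa mu \<longleftrightarrow>
     ordIso2 (card_of \<A>) lam \<and>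
     (\<forall>A\<in>\<A>. ordIso2 (card_of A) kappa) \<and>
     (\<forall>A\<in>\<A>. \<forall>A'\<in>\<A>. A \<noteq> A' \<longrightarrow> ordLess2 (card_of (A \<inter> A')) mu)"

definition essentially_disjoint :: "'b set set \<Rightarrow> 'k rel \<Rightarrow> bool" where
  "essentially_disjoint \<A> kappa \<longleftrightarrow>
     (\<exists>F. (\<forall>A\<in>\<A>. F A \<subseteq> A \<and> ordLess2 (card_of (F A)) kappa) \<and>
          (\<forall>A\<in>\<A>. \<forall>A'\<in>\<A>. A \<noteq> A' \<longrightarrow> (A - F A) \<inter> (A' - F A') = {}))"

definition chi_le :: "'b set set \<Rightarrow> 'r rel \<Rightarrow> bool" where
  "chi_le \<A> rho \<longleftrightarrow>
     (\<exists>f :: 'b \<Rightarrow> 'b set. ordLeq3 (card_of (f ` \<Union>\<A>)) rho \<and>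
        (\<forall>A\<in>\<A>. \<exists>x\<in>A. \<exists>y\<in>A. f x \<noteq> f y))"

end

theory Submission
  imports Defs "HOL-Library.Countable_Set_Type"
begin

text \<open>
  Suppose the family has size \<open>\<kappa>\<close> and all smaller families are essentially disjoint. By (i),
  either \<open>\<nu>\<^sup>\<omega> = \<nu>\<close> for cofinally many \<open>\<nu> < \<kappa>\<close>, or \<open>\<kappa> = \<mu>\<^sup>+\<close> with \<open>\<mu>\<close> of countable
  cofinality. In the first case the family is exhausted by an increasing chain of small subfamilies
  such that a set left outside a subfamily has a finite trace on its union; at limits the traces
  stay countable, so the layers can be treated separately.

  In the second case enumerate the countable subsets of \<open>\<mu>\<^sup>+\<close> as \<open>c\<^sub>\<xi>\<close> (\<open>\<xi> < \<mu>\<^sup>+\<close>) and call \<open>d\<close> bad if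
  it has cofinality \<open>\<omega>\<^sub>1\<close> and some uncountable \<open>A \<subseteq> d\<close> meets every \<open>c\<^sub>\<xi>\<close>, \<open>\<xi> < d\<close>, in a finite
  set. If the bad points are not stationary, the family is again split into layers, along a club.
  If they are, let diamond guess subsets \<open>G\<^sub>d \<subseteq> d\<close> and choose such sets \<open>B\<^sub>d \<subseteq> G\<^sub>d\<close> whenever possible;
  on a club they have finite intersections. A colouring of \<open>\<mu>\<^sup>+\<close> with \<open>\<omega>\<^sub>1\<close> colours has a colour class
  \<open>X\<close> of size \<open>\<mu>\<^sup>+\<close>, and an injection \<open>\<mu>\<^sup>+ \<rightarrow> X\<close> carries the witness \<open>A\<close> at a bad \<open>d\<close> where \<open>X\<close> is guessed
  to a suitable subset of \<open>G\<^sub>d\<close>, so \<open>B\<^sub>d\<close> is monochromatic. Hence the \<open>B\<^sub>d\<close> need more than \<open>\<omega>\<^sub>1\<close> colours.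
\<close>

unbundle cardinal_syntax

section \<open>Countable subsets of cardinals\<close>

lemma Cinfinite_card_of: "infinite A \<Longrightarrow> Cinfinite |A|"
  by (simp add: cinfinite_def Field_card_of card_of_card_order_on)

definition csub :: "'a set \<Rightarrow> 'a set set" where
  "csub A = {X. X \<subseteq> A \<and> countable X}"

lemma csub_mono:
  assumes "|A| \<le>o |B|"
  shows "|csub A| \<le>o |csub B|"
proof -
  obtain f where f: "inj_on f A" "f ` A \<subseteq> B"
    using assms unfolding card_of_ordLeq[symmetric] by blast
  have "inj_on (image f) (csub A)"
    by (rule inj_on_subset[OF inj_on_image_Pow[OF f(1)]]) (auto simp: csub_def)
  moreover have "image f ` csub A \<subseteq> csub B"
    using f(2) by (auto simp: csub_def)
  ultimately show ?thesis unfolding card_of_ordLeq[symmetric] by blast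
qed

text \<open>Nonempty countable sets are ranges of sequences. The empty set is not, but adding it
  does not change an infinite cardinal.\<close>

lemma csub_le_cexp:
  assumes "infinite A"
  shows "|csub A| \<le>o BNF_Cardinal_Arithmetic.cexp |A| natLeq"
proof -
  let ?P = "{X. X \<subseteq> A \<and> countable X \<and> X \<noteq> {}}"
  have "|A| \<le>o |?P|"
    by (rule card_of_ordLeqI[of "\<lambda>a. {a}"]) auto
  then have inf: "infinite ?P"
    using assms card_of_ordLeq_infinite by blast
  have "|{{} :: 'a set}| \<le>o |?P|"
    by (rule card_of_singl_ordLeq) (rule infinite_imp_nonempty[OF inf])
  then have "|{{}} \<union> ?P| \<le>o |?P|"
    by (rule Un_Cinfinite_bound[OF _ card_of_mono1[OF subset_refl] Cinfinite_card_of[OF inf]])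
  moreover have "csub A = {{}} \<union> ?P" by (auto simp: csub_def)
  ultimately have "|csub A| \<le>o |?P|" by simp
  then show ?thesis
    using card_of_countable_sets_Func ordLeq_transitive by blast
qed

lemma finite_csub: "finite A \<Longrightarrow> finite (csub A)"
  by (rule finite_subset[of _ "Pow A"]) (auto simp: csub_def)

lemma Card_order_Well_order: "Card_order r \<Longrightarrow> Well_order r"
  by (simp add: card_order_on_def)

text \<open>Once countable sets are bounded, they are all collected from the proper initial
  segments: a union of at most \<open>r\<close> families, each of size at most
  \<open>r\<close>.\<close>

lemma csub_Field_le:
  assumes "Cinfinite r"
    and bd: "\<And>X. X \<subseteq> Field r \<Longrightarrow> countable X \<Longrightarrow> \<exists>a\<in>Field r. X \<subseteq> underS r a"
    and le: "\<And>a. a \<in> Field r \<Longrightarrow> |csub (underS r a)| \<le>o r"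
  shows "|csub (Field r)| \<le>o r"
proof -
  have "csub (Field r) \<subseteq> (\<Union>a\<in>Field r. csub (underS r a))"
    using bd by (fastforce simp: csub_def)
  moreover have "|\<Union>a\<in>Field r. csub (underS r a)| \<le>o r"
    using UNION_Cinfinite_bound[of "Field r" r "\<lambda>a. csub (underS r a)"] assms(1) le
    by (meson card_of_Field_ordIso ordIso_iff_ordLeq)
  ultimately show ?thesis
    using card_of_mono1 ordLeq_transitive by blast
qed

section \<open>Initial segments of well-orders\<close>

lemma underS_le_trans:
  assumes "Well_order r" "x \<in> underS r y" "(y, z) \<in> r"
  shows "x \<in> underS r z"
  using assms underS_incr[of r y z]
  unfolding order_on_defs by blast

lemma underS_trans:
  assumes "Well_order r" "x \<in> underS r y" "y \<in> underS r z"
  shows "x \<in> underS r z"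
  using underS_le_trans[OF assms(1,2)] assms(3) unfolding underS_def by blast

lemma not_underS_iff:
  assumes "Well_order r" "x \<in> Field r" "y \<in> Field r"
  shows "x \<notin> underS r y \<longleftrightarrow> (y, x) \<in> r"
proof -
  interpret wo_rel r using assms(1) by (simp add: wo_rel_def)
  show ?thesis
    using TOTALS assms(2,3) antisymD[OF ANTISYM] unfolding underS_def by blast
qed

lemma le_underS_trans:
  assumes "Well_order r" "(x, y) \<in> r" "y \<in> underS r z"
  shows "x \<in> underS r z"
proof (rule ccontr)
  assume "x \<notin> underS r z"
  moreover have "x \<in> Field r" "z \<in> Field r"
    using assms unfolding underS_def Field_def by auto
  ultimately have "(z, x) \<in> r" using not_underS_iff[OF assms(1)] by blast
  then have "(z, y) \<in> r"
    using assms unfolding order_on_defs by (meson transD)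
  moreover have "y \<in> Field r" using assms(2) unfolding Field_def by auto
  ultimately show False
    using not_underS_iff[OF assms(1) _ \<open>z \<in> Field r\<close>] assms(3) by blast
qed

lemma Well_order_least:
  assumes "Well_order r" "A \<subseteq> Field r" "A \<noteq> {}"
  obtains m where "m \<in> A" "\<And>a. a \<in> A \<Longrightarrow> (m, a) \<in> r"
proof -
  interpret wo_rel r using assms(1) by (simp add: wo_rel_def)
  show thesis
    using that[of "minim A"] minim_in[OF assms(2,3)] minim_least[OF assms(2)] by blast
qed

lemma Card_order_limit:
  assumes "Cinfinite r" "a \<in> Field r"
  shows "\<exists>b\<in>Field r. a \<in> underS r b"
  using infinite_Card_order_limit[of r a] assms unfolding cinfinite_def underS_def by blast

lemma finite_underS_bound:
  assumes r: "Cinfinite r" and "finite K" "K \<subseteq> Field r"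
  shows "\<exists>a\<in>Field r. K \<subseteq> underS r a"
  using assms(2,3)
proof (induction K)
  case empty
  have "Field r \<noteq> {}" using r by (auto simp: cinfinite_def)
  then show ?case by auto
next
  case (insert x K)
  have W: "Well_order r" using r Card_order_Well_order by blast
  from insert obtain a where a: "a \<in> Field r" "K \<subseteq> underS r a" by auto
  show ?case
  proof (cases "x \<in> underS r a")
    case False
    then have ax: "(a, x) \<in> r" using not_underS_iff[OF W] insert a by auto
    obtain b where b: "b \<in> Field r" "x \<in> underS r b"
      using Card_order_limit[OF r] insert by blast
    have "K \<subseteq> underS r b"
      using a ax b underS_le_trans[OF W] underS_trans[OF W] by blast
    with b show ?thesis by auto
  qed (use a in auto)
qed

section \<open>Cofinal and bounded sets\<close>

lemma cofinal_in_infinite: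
  assumes r: "Cinfinite r" and K: "cofinal_in r K"
  shows "infinite K"
proof
  assume "finite K"
  then obtain a where a: "a \<in> Field r" "K \<subseteq> underS r a"
    using finite_underS_bound[OF r, of K] K unfolding cofinal_in_def by blast
  then obtain b where "b \<in> K" "(a, b) \<in> r" using K unfolding cofinal_in_def by blast
  with a show False
    using not_underS_iff[of r b a] r Card_order_Well_order K unfolding cofinal_in_def by blast
qed

lemma cofinal_in_or_bounded:
  assumes "Well_order r" "X \<subseteq> Field r"
  shows "cofinal_in r X \<or> (\<exists>a\<in>Field r. X \<subseteq> underS r a)"
  using assms not_underS_iff[OF assms(1)] unfolding cofinal_in_def by blast

text \<open>An unbounded countable set would be cofinal and infinite; as no finite set is cofinal,
  it would witness cofinality omega.\<close>

lemma countable_bounded_if_not_has_cof: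
  assumes r: "Cinfinite r" and nc: "\<not> has_cof r natLeq"
    and X: "X \<subseteq> Field r" "countable X"
  shows "\<exists>a\<in>Field r. X \<subseteq> underS r a"
proof (rule ccontr)
  assume "\<not> ?thesis"
  then have c: "cofinal_in r X"
    using cofinal_in_or_bounded[OF _ X(1)] r Card_order_Well_order by blast
  then have "infinite X" using cofinal_in_infinite[OF r] by blast
  then have "|X| =o natLeq"
    using X(2) infinite_iff_natLeq_ordLeq unfolding countable_card_le_natLeq ordIso_iff_ordLeq by blast
  then have "has_cof r natLeq"
    unfolding has_cof_def using c cofinal_in_infinite[OF r] infinite_iff_natLeq_ordLeq by blast
  with nc show False by blast
qed

text \<open>Regularity of successor cardinals: an unbounded set would have the full size of
  \<open>cardSuc k\<close>.\<close>

lemma cardSuc_bounded: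
  assumes k: "Cinfinite k" and X: "X \<subseteq> Field (cardSuc k)" "|X| \<le>o k"
  shows "\<exists>a\<in>Field (cardSuc k). X \<subseteq> underS (cardSuc k) a"
proof (rule ccontr)
  let ?r = "cardSuc k"
  assume nb: "\<not> ?thesis"
  have r: "Cinfinite ?r" using Cinfinite_cardSuc[OF k] .
  then have W: "Well_order ?r" using Card_order_Well_order by blast
  have "cofinal X ?r" unfolding cofinal_def
  proof
    fix a assume "a \<in> Field ?r"
    \<comment> \<open>\<open>cofinal\<close> asks for a strictly larger element, so the search
      starts at some \<open>b\<close> beyond \<open>a\<close>.\<close>
    then obtain b where "b \<in> Field ?r" "a \<in> underS ?r b" using Card_order_limit[OF r] by blast
    moreover obtain c where "c \<in> X" "(b, c) \<in> ?r"
      using nb \<open>b \<in> Field ?r\<close> not_underS_iff[OF W] X(1) by blast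
    ultimately have "a \<in> underS ?r c" using underS_le_trans[OF W] by blast
    with \<open>c \<in> X\<close> show "\<exists>c\<in>X. a \<noteq> c \<and> (a, c) \<in> ?r"
      unfolding underS_def by blast
  qed
  then have "|X| =o ?r"
    using regularCard_cardSuc[OF k] X(1) unfolding regularCard_def by blast
  moreover have "|X| <o ?r"
    using X(2) k cardSuc_ordLeq_ordLess card_of_Card_order by blast
  ultimately show False using not_ordLess_ordIso by blast
qed

lemma underS_cardSuc_le:
  assumes "Card_order k" "a \<in> Field (cardSuc k)"
  shows "|underS (cardSuc k) a| \<le>o k"
  using assms card_of_underS[OF cardSuc_Card_order] cardSuc_ordLeq_ordLess card_of_Card_order
  by blast

section \<open>Counting countable subsets under hypothesis (i)\<close>

lemma csub_cardSuc_le: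
  assumes k: "Cinfinite k"
    and le: "\<And>a. a \<in> Field (cardSuc k) \<Longrightarrow> |csub (underS (cardSuc k) a)| \<le>o cardSuc k"
  shows "|csub (Field (cardSuc k))| \<le>o cardSuc k"
proof (rule csub_Field_le)
  show "Cinfinite (cardSuc k)" using Cinfinite_cardSuc[OF k] .
  fix X assume "X \<subseteq> Field (cardSuc k)" "countable X"
  moreover from this have "|X| \<le>o k"
    using natLeq_ordLeq_cinfinite[OF k] ordLeq_transitive countable_card_le_natLeq by blast
  ultimately show "\<exists>a\<in>Field (cardSuc k). X \<subseteq> underS (cardSuc k) a"
    using cardSuc_bounded[OF k] by blast
qed (use le in auto)

text \<open>Hypothesis (i), with lambda taken to be the cardinal of the type \<open>'l\<close>. The
  \<open>itself\<close> argument serves to name that type.\<close>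

abbreviation countable_cof_hyp :: "'l itself \<Rightarrow> bool" where
  "countable_cof_hyp _ \<equiv> \<forall>M :: 'l set. |M| <o |UNIV :: 'l set| \<and> has_cof |M| natLeq \<longrightarrow>
     BNF_Cardinal_Arithmetic.cexp |M| natLeq =o cardSuc |M|"

text \<open>Induction on the cardinal of \<open>M\<close>. At cofinality omega hypothesis (i)
  applies. Otherwise countable sets are bounded, and an infinite initial segment \<open>U\<close>
  has at most \<open>cardSuc |U|\<close> countable subsets, which does not exceed the cardinal of
  \<open>M\<close>.\<close>

lemma csub_le_cardSuc:
  fixes M :: "'l set"
  assumes H: "countable_cof_hyp TYPE('l)"
    and "infinite M" "|M| <o |UNIV :: 'l set|"
  shows "|csub M| \<le>o cardSuc |M| \<and> (\<not> has_cof |M| natLeq \<longrightarrow> |csub M| \<le>o |M| )"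
  using assms(2,3)
proof (induction M rule: wf_induct_rule[OF wf_inv_image[OF wf_ordLess, of card_of]])
  case (1 M)
  show ?case
  proof (cases "has_cof |M| natLeq")
    case True
    with H 1(3) have "BNF_Cardinal_Arithmetic.cexp |M| natLeq =o cardSuc |M|" by blast
    with csub_le_cexp[OF 1(2)] True show ?thesis
      using ordLeq_ordIso_trans by blast
  next
    case False
    have M: "Cinfinite |M|" using 1(2) Cinfinite_card_of by blast
    have "|csub (Field |M| )| \<le>o |M|"
    proof (rule csub_Field_le[OF M])
      fix X assume "X \<subseteq> Field |M|" "countable X"
      then show "\<exists>a\<in>Field |M|. X \<subseteq> underS |M| a"
        using countable_bounded_if_not_has_cof[OF M False] by blast
    next
      fix a assume a: "a \<in> Field |M|"
      let ?U = "underS |M| a"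
      have less: "|?U| <o |M|" using card_of_underS[OF card_of_Card_order a] .
      show "|csub ?U| \<le>o |M|"
      proof (cases "finite ?U")
        case True
        then show ?thesis
          using finite_csub 1(2) ordLess_imp_ordLeq[OF finite_ordLess_infinite[OF card_of_Well_order card_of_Well_order]]
          by (metis Field_card_of)
      next
        case False
        have "|csub ?U| \<le>o cardSuc |?U|"
          using 1(1)[of ?U] less False 1(3) ordLess_transitive by (auto simp: inv_image_def)
        also have "cardSuc |?U| \<le>o |M|"
          using less cardSuc_least card_of_Card_order by blast
        finally show ?thesis .
      qed
    qed
    then have le: "|csub M| \<le>o |M|" by (simp add: Field_card_of)
    moreover have "|M| \<le>o cardSuc |M|" using cardSuc_ordLeq card_of_Card_order by blast
    ultimately show ?thesis using ordLeq_transitive by blast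
  qed
qed

section \<open>Essential disjointness by layers\<close>

lemma Cinfinite_omega1: "Cinfinite omega1"
  using Cinfinite_cardSuc[OF natLeq_Cinfinite] .

lemma countable_iff_less_omega1: "countable A \<longleftrightarrow> |A| <o omega1"
  unfolding cardSuc_ordLeq_ordLess[OF natLeq_Card_order card_of_Card_order]
  by (rule countable_card_le_natLeq)

lemma omega1_le_iff_uncountable: "omega1 \<le>o |A| \<longleftrightarrow> uncountable A"
  unfolding countable_iff_less_omega1
  using not_ordLess_iff_ordLeq[OF cardSuc_Well_order[OF natLeq_Card_order] card_of_Well_order]
  by blast

text \<open>Replacing \<open>F A\<close> by \<open>A \<inter> F A\<close> does not change
  \<open>A - F A\<close>, and having size below \<open>omega1\<close> means being countable.\<close>

lemma essentially_disjoint_iff: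
  "essentially_disjoint \<A> omega1 \<longleftrightarrow>
    (\<exists>F. (\<forall>A\<in>\<A>. countable (F A)) \<and>
      (\<forall>A\<in>\<A>. \<forall>B\<in>\<A>. A \<noteq> B \<longrightarrow> (A - F A) \<inter> (B - F B) = {}))" (is "?l \<longleftrightarrow> ?r")
proof
  assume ?l
  then obtain F where "(\<forall>A\<in>\<A>. F A \<subseteq> A \<and> countable (F A)) \<and>
      (\<forall>A\<in>\<A>. \<forall>B\<in>\<A>. A \<noteq> B \<longrightarrow> (A - F A) \<inter> (B - F B) = {})"
    unfolding essentially_disjoint_def countable_iff_less_omega1[symmetric] by (rule exE)
  then show ?r by (intro exI[of _ F]) simp
next
  assume ?r
  then obtain F where F: "\<forall>A\<in>\<A>. countable (F A)"
    "\<forall>A\<in>\<A>. \<forall>B\<in>\<A>. A \<noteq> B \<longrightarrow> (A - F A) \<inter> (B - F B) = {}"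
    by (elim exE conjE)
  show ?l
    unfolding essentially_disjoint_def countable_iff_less_omega1[symmetric]
    by (rule exI[of _ "\<lambda>A. A \<inter> F A"]) (use F in \<open>auto simp: Diff_Int2\<close>)
qed

text \<open>From each member remove the set provided by its own fibre together with its countable
  overlap with all members of smaller rank. Of two members with different ranks, the later one has
  then lost the whole intersection.\<close>

lemma essentially_disjoint_by_rank:
  assumes total: "\<And>A B. A \<in> \<A> \<Longrightarrow> B \<in> \<A> \<Longrightarrow> r A = r B \<or> (r A, r B) \<in> R \<or> (r B, r A) \<in> R"
    and fibre: "\<And>A. A \<in> \<A> \<Longrightarrow> essentially_disjoint {B \<in> \<A>. r B = r A} omega1"
    and below: "\<And>A. A \<in> \<A> \<Longrightarrow> countable (A \<inter> \<Union>{B \<in> \<A>. (r B, r A) \<in> R})"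
  shows "essentially_disjoint \<A> omega1"
proof -
  let ?P = "\<lambda>i F. (\<forall>A\<in>{B \<in> \<A>. r B = i}. countable (F A)) \<and>
    (\<forall>A\<in>{B \<in> \<A>. r B = i}. \<forall>B\<in>{B \<in> \<A>. r B = i}. A \<noteq> B \<longrightarrow> (A - F A) \<inter> (B - F B) = {})"
  have "\<forall>i\<in>r ` \<A>. \<exists>F. ?P i F"
    using fibre by (auto simp: essentially_disjoint_iff)
  then obtain F where F: "\<forall>i\<in>r ` \<A>. ?P i (F i)" by (rule bchoice[THEN exE])
  define G where "G A = F (r A) A \<union> (A \<inter> \<Union>{B \<in> \<A>. (r B, r A) \<in> R})" for A
  have disj: "(A - G A) \<inter> (B - G B) = {}" if "A \<in> \<A>" "B \<in> \<A>" "A \<noteq> B" for A B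
    using total[OF that(1,2)]
  proof (elim disjE)
    assume "r A = r B"
    then have "(A - F (r A) A) \<inter> (B - F (r A) B) = {}"
      using F[rule_format, of "r A"] that by auto
    with \<open>r A = r B\<close> show ?thesis unfolding G_def by auto
  qed (use that in \<open>auto simp: G_def\<close>)
  have "countable (G A)" if "A \<in> \<A>" for A
    using F[rule_format, of "r A"] below[OF that] that by (auto simp: G_def)
  with disj show ?thesis unfolding essentially_disjoint_iff by (intro exI[of _ G]) blast
qed

text \<open>The sizes prescribed by \<open>is_system\<close> become upper bounds, so that the class
  is closed under subfamilies and an induction on the size can descend to them.\<close>

definition almost_disjoint_family :: "'b set set \<Rightarrow> bool" where
  "almost_disjoint_family \<A> \<longleftrightarrow>
    (\<forall>A\<in>\<A>. |A| \<le>o omega1) \<and> (\<forall>A\<in>\<A>. \<forall>B\<in>\<A>. A \<noteq> B \<longrightarrow> finite (A \<inter> B))"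

lemma almost_disjoint_family_subset:
  "almost_disjoint_family \<A> \<Longrightarrow> \<B> \<subseteq> \<A> \<Longrightarrow> almost_disjoint_family \<B>"
  unfolding almost_disjoint_family_def by blast

text \<open>In a well-order of type at most \<open>omega1\<close> each member has countably many
  predecessors and meets each of them in a finite set. The rank of a member is the member
  itself.\<close>

lemma essentially_disjoint_if_le_omega1:
  assumes ad: "almost_disjoint_family \<A>" and le: "|\<A>| \<le>o omega1"
  shows "essentially_disjoint \<A> omega1"
proof (rule essentially_disjoint_by_rank[where r = "\<lambda>A. A" and R = "|\<A>| - Id"])
  fix A assume A: "A \<in> \<A>"
  have "{B \<in> \<A>. (B, A) \<in> |\<A>| - Id} = underS |\<A>| A"
    using Order_Relation.underS_Field[of "|\<A>|" A] by (auto simp: underS_def Field_card_of)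
  moreover have "countable (underS |\<A>| A)"
    using card_of_underS[of "|\<A>|" A] card_of_Card_order[of \<A>] A ordLess_ordLeq_trans[OF _ le]
    unfolding countable_iff_less_omega1 Field_card_of by blast
  moreover have "countable (A \<inter> B)" if "B \<in> underS |\<A>| A" for B
    using that A ad Order_Relation.underS_Field[of "|\<A>|" A] underS_notIn[of A "|\<A>|"]
    unfolding almost_disjoint_family_def Field_card_of
    by (metis countable_finite in_mono)
  ultimately show "countable (A \<inter> \<Union>{B \<in> \<A>. (B, A) \<in> |\<A>| - Id})"
    unfolding Int_Union by (metis countable_UN)
next
  fix A assume A: "A \<in> \<A>"
  then have "{B \<in> \<A>. B = A} = {A}" by auto
  then show "essentially_disjoint {B \<in> \<A>. B = A} omega1"
    unfolding essentially_disjoint_iff by (auto intro!: exI[of _ "\<lambda>_. {}"])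
next
  fix A B assume "A \<in> \<A>" "B \<in> \<A>"
  then show "A = B \<or> (A, B) \<in> |\<A>| - Id \<or> (B, A) \<in> |\<A>| - Id"
    using card_of_Well_order[of \<A>] unfolding order_on_defs total_on_def Field_card_of by blast
qed

text \<open>Choose a countably infinite subset of each infinite trace; distinct members cannot share
  one, because their intersection is finite.\<close>

lemma infinite_traces_le:
  assumes ad: "almost_disjoint_family \<A>"
  shows "|{A \<in> \<A>. infinite (A \<inter> U)}| \<le>o |csub U|"
proof -
  have "\<forall>A\<in>{A \<in> \<A>. infinite (A \<inter> U)}. \<exists>C. C \<subseteq> A \<inter> U \<and> countable C \<and> infinite C"
    using infinite_countable_subset' by (metis (no_types, lifting) mem_Collect_eq)
  then obtain c where c: "\<And>A. A \<in> {A \<in> \<A>. infinite (A \<inter> U)} \<Longrightarrow>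
      c A \<subseteq> A \<inter> U \<and> countable (c A) \<and> infinite (c A)" by metis
  have "inj_on c {A \<in> \<A>. infinite (A \<inter> U)}"
  proof (rule inj_onI, rule ccontr)
    fix A B assume AB: "A \<in> {A \<in> \<A>. infinite (A \<inter> U)}" "B \<in> {A \<in> \<A>. infinite (A \<inter> U)}"
      "c A = c B" "A \<noteq> B"
    then have "finite (A \<inter> B)" using ad unfolding almost_disjoint_family_def by blast
    moreover have "c A \<subseteq> A \<inter> B" using c[OF AB(1)] c[OF AB(2)] AB(3) by blast
    ultimately show False using c[OF AB(1)] finite_subset by blast
  qed
  moreover have "c ` {A \<in> \<A>. infinite (A \<inter> U)} \<subseteq> csub U"
    using c unfolding csub_def by blast
  ultimately show ?thesis unfolding card_of_ordLeq[symmetric] by blast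
qed

section \<open>Subfamilies closed under infinite traces\<close>

definition traces :: "'b set set \<Rightarrow> 'b set set \<Rightarrow> 'b set set" where
  "traces \<A> N = {A \<in> \<A>. infinite (A \<inter> \<Union>N)}"

lemma traces_mono: "N \<subseteq> N' \<Longrightarrow> traces \<A> N \<subseteq> traces \<A> N'"
  unfolding traces_def using finite_subset[of "_ \<inter> \<Union>N" "_ \<inter> \<Union>N'"] by blast

text \<open>The closure of \<open>X\<close> under absorbing members with infinite trace. A member of
  \<open>\<A>\<close> left outside meets the union of the closure in a finite set, which is what the
  layers need.\<close>

definition hull :: "'b set set \<Rightarrow> 'b set set \<Rightarrow> 'b set set" where
  "hull \<A> X = \<Inter>{N. X \<subseteq> N \<and> traces \<A> N \<subseteq> N}"

lemma subset_hull: "X \<subseteq> hull \<A> X"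
  unfolding hull_def by blast

lemma hull_least: "X \<subseteq> N \<Longrightarrow> traces \<A> N \<subseteq> N \<Longrightarrow> hull \<A> X \<subseteq> N"
  unfolding hull_def by blast

lemma hull_subset: "X \<subseteq> \<A> \<Longrightarrow> hull \<A> X \<subseteq> \<A>"
  by (rule hull_least) (auto simp: traces_def)

lemma hull_mono: "X \<subseteq> Y \<Longrightarrow> hull \<A> X \<subseteq> hull \<A> Y"
  unfolding hull_def by blast

lemma traces_hull: "traces \<A> (hull \<A> X) \<subseteq> hull \<A> X"
proof
  fix A assume A: "A \<in> traces \<A> (hull \<A> X)"
  have "A \<in> N" if N: "X \<subseteq> N" "traces \<A> N \<subseteq> N" for N
    using A traces_mono[OF hull_least[OF N]] N(2) by blast
  then show "A \<in> hull \<A> X" unfolding hull_def by blast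
qed

text \<open>\<open>Z\<close> represents a cardinal with no more countable subsets than elements. The
  union of \<open>N\<close> has size at most \<open>|Z|\<close>, hence at most that many countable
  subsets, and these bound the number of infinite traces.\<close>

lemma traces_le:
  assumes ad: "almost_disjoint_family \<A>" and N: "N \<subseteq> \<A>" "|N| \<le>o |Z|"
    and Z: "omega1 \<le>o |Z|" "|csub Z| \<le>o |Z|"
  shows "|traces \<A> N| \<le>o |Z|"
proof -
  have inf: "infinite Z" using Z(1) omega1_le_iff_uncountable countable_finite by blast
  have "\<forall>A\<in>N. |A| \<le>o |Z|"
    using ad N(1) Z(1) ordLeq_transitive unfolding almost_disjoint_family_def by blast
  then have "|\<Union>A\<in>N. A| \<le>o |Z|"
    using card_of_UNION_ordLeq_infinite[OF inf N(2), of "\<lambda>A. A"] by blast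
  then have "|\<Union>N| \<le>o |Z|" by simp
  then have "|csub (\<Union>N)| \<le>o |Z|"
    using csub_mono Z(2) ordLeq_transitive by blast
  then show ?thesis
    unfolding traces_def by (rule ordLeq_transitive[OF infinite_traces_le[OF ad]])
qed

text \<open>
  The hull is reached after \<open>\<omega>\<^sub>1\<close> steps, since a countable subset of the union appears at an earlier step.
\<close>
lemma hull_le:
  assumes ad: "almost_disjoint_family \<A>" and X: "X \<subseteq> \<A>" "|X| \<le>o |Z|"
    and Z: "omega1 \<le>o |Z|" "|csub Z| \<le>o |Z|"
  shows "|hull \<A> X| \<le>o |Z|"
proof -
  have inf: "infinite Z" using Z(1) omega1_le_iff_uncountable countable_finite by blast
  have W: "Well_order omega1" using Cinfinite_omega1 Card_order_Well_order by blast
  let ?R = "omega1 - Id"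
  have wf: "wf ?R" using W unfolding well_order_on_def by blast
  \<comment> \<open>One recursion clause covers zero, successor and limit stages: each stage absorbs
    the traces on the union of all earlier ones.\<close>
  define G where "G f i = X \<union> traces \<A> (\<Union>j\<in>underS omega1 i. f j)" for f :: "nat set \<Rightarrow> _" and i
  define N where "N = wfrec ?R G"
  have "adm_wf ?R G"
    unfolding adm_wf_def G_def underS_def by (auto intro!: arg_cong[of _ _ "traces \<A>"])
  then have "N = G N" unfolding N_def by (rule wfrec_fixpoint[OF wf])
  then have N: "N i = X \<union> traces \<A> (\<Union>j\<in>underS omega1 i. N j)" for i
    unfolding G_def by metis
  have sub: "N i \<subseteq> \<A>" for i
    using N[of i] X(1) unfolding traces_def by blast
  have le: "|N i| \<le>o |Z|" if "i \<in> Field omega1" for i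
    using wf that
  proof (induction i)
    case (less i)
    let ?U = "\<Union>j\<in>underS omega1 i. N j"
    have "|underS omega1 i| \<le>o |Z|"
      using underS_cardSuc_le[OF natLeq_Card_order less.prems] infinite_iff_natLeq_ordLeq inf
        ordLeq_transitive by blast
    moreover have "\<forall>j\<in>underS omega1 i. |N j| \<le>o |Z|"
      using less.IH by (auto simp: underS_def intro: FieldI1)
    ultimately have "|?U| \<le>o |Z|"
      using card_of_UNION_ordLeq_infinite[OF inf] by blast
    then have "|traces \<A> ?U| \<le>o |Z|"
      using traces_le[OF ad _ _ Z] sub by (metis UN_least)
    with X(2) show ?case
      unfolding N[of i] using Un_Cinfinite_bound Cinfinite_card_of[OF inf] by blast
  qed
  let ?H = "\<Union>i\<in>Field omega1. N i"
  have "|Field omega1| \<le>o |Z|"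
    using Z(1) card_of_mono2 by (metis Field_card_of)
  then have H_le: "|?H| \<le>o |Z|"
    using card_of_UNION_ordLeq_infinite[OF inf] le by blast
  have "hull \<A> X \<subseteq> ?H"
  proof (rule hull_least)
    have "Field omega1 \<noteq> {}" using Cinfinite_omega1 by (auto simp: cinfinite_def)
    then show "X \<subseteq> ?H" using N by blast
    show "traces \<A> ?H \<subseteq> ?H"
    proof
      fix A assume A: "A \<in> traces \<A> ?H"
      then obtain c where c: "c \<subseteq> A \<inter> \<Union>?H" "countable c" "infinite c"
        unfolding traces_def using infinite_countable_subset' by blast
      then have "\<forall>x\<in>c. \<exists>i. i \<in> Field omega1 \<and> x \<in> \<Union>(N i)" by blast
      then obtain i where i: "\<And>x. x \<in> c \<Longrightarrow> i x \<in> Field omega1 \<and> x \<in> \<Union>(N (i x))" by metis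
      have "|i ` c| \<le>o natLeq"
        using c(2) countable_card_le_natLeq countable_image by blast
      moreover have "i ` c \<subseteq> Field omega1" using i by blast
      ultimately have "\<exists>a\<in>Field omega1. i ` c \<subseteq> underS omega1 a"
        using cardSuc_bounded[OF natLeq_Cinfinite] by blast
      then obtain a where a: "a \<in> Field omega1" "i ` c \<subseteq> underS omega1 a" by (rule bexE)
      have "c \<subseteq> A \<inter> \<Union>(\<Union>j\<in>underS omega1 a. N j)"
      proof
        fix x assume x: "x \<in> c"
        then have "i x \<in> underS omega1 a" using a(2) by auto
        then show "x \<in> A \<inter> \<Union>(\<Union>j\<in>underS omega1 a. N j)" using x i[OF x] c(1) by auto
      qed
      then have "A \<in> traces \<A> (\<Union>j\<in>underS omega1 a. N j)"
        using A c(3) finite_subset unfolding traces_def by blast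
      then show "A \<in> ?H" using N[of a] a(1) by blast
    qed
  qed
  then show ?thesis using H_le card_of_mono1 ordLeq_transitive by blast
qed

text \<open>Well-order the family in the type of its cardinal. The hulls \<open>N a\<close> of the
  initial segments form an increasing chain, kept small by the cardinals \<open>Z\<close>. The rank
  of a member is the first \<open>a\<close> with the member in \<open>N a\<close>.\<close>

lemma essentially_disjoint_if_closed_bounds:
  fixes \<A> :: "'b set set"
  assumes ad: "almost_disjoint_family \<A>" and inf: "infinite \<A>"
    and Z: "\<And>X. X \<subseteq> \<A> \<Longrightarrow> |X| <o |\<A>| \<Longrightarrow>
      \<exists>Z :: 'c set. |X| \<le>o |Z| \<and> |Z| <o |\<A>| \<and> omega1 \<le>o |Z| \<and> |csub Z| \<le>o |Z|"
    and IH: "\<And>\<B>. \<B> \<subseteq> \<A> \<Longrightarrow> |\<B>| <o |\<A>| \<Longrightarrow> essentially_disjoint \<B> omega1"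
  shows "essentially_disjoint \<A> omega1"
proof -
  let ?w = "|\<A>|"
  have w: "Cinfinite ?w" using Cinfinite_card_of[OF inf] .
  then have W: "Well_order ?w" using Card_order_Well_order by blast
  have F: "Field ?w = \<A>" by (rule Field_card_of)
  define N where "N a = hull \<A> (underS ?w a)" for a
  have N_sub: "N a \<subseteq> \<A>" for a
    unfolding N_def using hull_subset Order_Relation.underS_Field[of ?w] F by metis
  have N_less: "|N a| <o ?w" if "a \<in> \<A>" for a
  proof -
    have "underS ?w a \<subseteq> \<A>" using Order_Relation.underS_Field[of ?w] F by metis
    moreover have "|underS ?w a| <o ?w" using card_of_underS w that F by metis
    ultimately obtain Z :: "'c set" where "|underS ?w a| \<le>o |Z|" "|Z| <o |\<A>|"
      "omega1 \<le>o |Z|" "|csub Z| \<le>o |Z|" using Z by blast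
    then show ?thesis
      unfolding N_def using hull_le[OF ad] \<open>underS ?w a \<subseteq> \<A>\<close> ordLeq_ordLess_trans by blast
  qed
  have N_mono: "N a \<subseteq> N b" if "(a, b) \<in> ?w" for a b
    unfolding N_def by (rule hull_mono) (use underS_le_trans[OF W _ that] in blast)
  have "\<exists>m. m \<in> \<A> \<and> A \<in> N m \<and> (\<forall>a\<in>\<A>. A \<in> N a \<longrightarrow> (m, a) \<in> ?w)" if A: "A \<in> \<A>" for A
  proof -
    have "{a \<in> \<A>. A \<in> N a} \<noteq> {}"
      using Card_order_limit[OF w] A subset_hull unfolding N_def F by blast
    then obtain m where "m \<in> {a \<in> \<A>. A \<in> N a}" "\<And>a. a \<in> {a \<in> \<A>. A \<in> N a} \<Longrightarrow> (m, a) \<in> ?w"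
      using Well_order_least[OF W, of "{a \<in> \<A>. A \<in> N a}"] F by blast
    then show ?thesis by blast
  qed
  then obtain r where r: "\<And>A. A \<in> \<A> \<Longrightarrow> r A \<in> \<A>" "\<And>A. A \<in> \<A> \<Longrightarrow> A \<in> N (r A)"
    "\<And>A a. A \<in> \<A> \<Longrightarrow> a \<in> \<A> \<Longrightarrow> A \<in> N a \<Longrightarrow> (r A, a) \<in> ?w" by metis
  show ?thesis
  proof (rule essentially_disjoint_by_rank[where r = r and R = "?w - Id"])
    fix A B assume "A \<in> \<A>" "B \<in> \<A>"
    then show "r A = r B \<or> (r A, r B) \<in> ?w - Id \<or> (r B, r A) \<in> ?w - Id"
      using W r(1) F unfolding order_on_defs total_on_def by blast
  next
    fix A assume A: "A \<in> \<A>"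
    have "{B \<in> \<A>. r B = r A} \<subseteq> N (r A)" using r(2) by force
    then have "|{B \<in> \<A>. r B = r A}| <o ?w"
      using N_less[OF r(1)[OF A]] card_of_mono1 ordLeq_ordLess_trans by blast
    then show "essentially_disjoint {B \<in> \<A>. r B = r A} omega1" by (rule IH[rotated]) simp
  next
    fix A assume A: "A \<in> \<A>"
    let ?L = "underS ?w (r A)"
    have LA: "?L \<subseteq> \<A>" using Order_Relation.underS_Field[of ?w] F by metis
    have "A \<notin> N b" if "b \<in> ?L" for b
      using r(3)[OF A, of b] that LA not_underS_iff[OF W, of b "r A"] r(1)[OF A] F by blast
    then have fin: "finite (A \<inter> \<Union>(N b))" if "b \<in> ?L" for b
      using that traces_hull[of \<A> "underS ?w b"] A unfolding N_def traces_def by blast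
    let ?U = "A \<inter> (\<Union>b\<in>?L. \<Union>(N b))"
    have "countable ?U"
    proof (cases "finite ?U")
      case False
      \<comment> \<open>No single finite trace contains the infinite set \<open>c\<close>, so the
        stages of its points are cofinal below \<open>r A\<close>. The whole trace is then a
        countable union of finite ones.\<close>
      then obtain c where c: "c \<subseteq> ?U" "countable c" "infinite c"
        using infinite_countable_subset' by blast
      then have "\<forall>x\<in>c. \<exists>b. b \<in> ?L \<and> x \<in> \<Union>(N b)" by blast
      then obtain k where k: "\<And>x. x \<in> c \<Longrightarrow> k x \<in> ?L \<and> x \<in> \<Union>(N (k x))" by metis
      have cof: "\<exists>x\<in>c. (b, k x) \<in> ?w" if b: "b \<in> ?L" for b
      proof (rule ccontr)
        assume "\<not> ?thesis"
        then have "(k x, b) \<in> ?w" if "x \<in> c" for x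
          using that k LA b not_underS_iff[OF W, of "k x" b] F unfolding underS_def by blast
        then have "c \<subseteq> A \<inter> \<Union>(N b)" using k N_mono c(1) by blast
        then show False using fin[OF b] c(3) finite_subset by blast
      qed
      have "?U \<subseteq> (\<Union>x\<in>c. A \<inter> \<Union>(N (k x)))"
      proof
        fix y assume "y \<in> ?U"
        then obtain b where "b \<in> ?L" "y \<in> A" "y \<in> \<Union>(N b)" by blast
        moreover from this cof obtain x where "x \<in> c" "(b, k x) \<in> ?w" by blast
        ultimately show "y \<in> (\<Union>x\<in>c. A \<inter> \<Union>(N (k x)))" using N_mono by blast
      qed
      moreover have "countable (\<Union>x\<in>c. A \<inter> \<Union>(N (k x)))"
      proof (rule countable_UN[OF c(2)])
        show "countable (A \<inter> \<Union>(N (k x)))" if "x \<in> c" for x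
          using countable_finite[OF fin] k[OF that] by blast
      qed
      ultimately show ?thesis using countable_subset by blast
    qed (rule countable_finite)
    moreover have "A \<inter> \<Union>{B \<in> \<A>. (r B, r A) \<in> ?w - Id} \<subseteq> ?U"
      using r(2) unfolding underS_def by blast
    ultimately show "countable (A \<inter> \<Union>{B \<in> \<A>. (r B, r A) \<in> ?w - Id})"
      using countable_subset by blast
  qed
qed

section \<open>Clubs and cofinality\<close>

text \<open>Set-valued maps allow several closure requirements to be merged by unions. The least
  point is excluded because \<open>club_closed\<close> needs a nonempty initial segment.\<close>

definition closure_points :: "'a rel \<Rightarrow> ('a \<Rightarrow> 'a set) \<Rightarrow> 'a set" where
  "closure_points W g = {d \<in> Field W. underS W d \<noteq> {} \<and> (\<forall>x\<in>underS W d. g x \<subseteq> underS W d)}"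

text \<open>For unboundedness, iterate a bounding function \<open>s\<close> omega times from
  \<open>a\<close> and take the supremum. Closedness holds because every point below a limit of
  closure points already lies below one of them.\<close>

lemma club_closure_points:
  assumes k: "Cinfinite k"
    and g: "\<And>x. x \<in> Field (cardSuc k) \<Longrightarrow> g x \<subseteq> Field (cardSuc k) \<and> |g x| \<le>o k"
  shows "club (cardSuc k) (closure_points (cardSuc k) g)"
proof -
  let ?W = "cardSuc k" and ?D = "closure_points (cardSuc k) g"
  have W: "Well_order ?W" using Card_order_Well_order Cinfinite_cardSuc[OF k] by blast
  have unb: "\<exists>c\<in>?D. a \<in> underS ?W c" if a: "a \<in> Field ?W" for a
  proof -
    \<comment> \<open>The bound must exceed \<open>x\<close> and the values of \<open>g\<close> at
      all points up to \<open>x\<close>; these are at most \<open>k\<close> sets of size at most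
      \<open>k\<close>, so regularity provides it.\<close>
    have "\<exists>b\<in>Field ?W. insert x (\<Union>y\<in>insert x (underS ?W x). g y) \<subseteq> underS ?W b"
      if x: "x \<in> Field ?W" for x
    proof (rule cardSuc_bounded[OF k])
      have sub: "insert x (underS ?W x) \<subseteq> Field ?W"
        using x Order_Relation.underS_Field[of ?W x] by simp
      then show "insert x (\<Union>y\<in>insert x (underS ?W x). g y) \<subseteq> Field ?W"
        using g by blast
      have one: "|{x}| \<le>o k"
        using k card_of_singl_ordLeq[of "Field k" x] card_of_Field_ordIso ordLeq_ordIso_trans
        by (metis cinfinite_def finite.emptyI)
      have "|{x} \<union> underS ?W x| \<le>o k"
        using underS_cardSuc_le[of k x] k x by (intro Un_Cinfinite_bound[OF one]) auto
      then have "|\<Union>y\<in>insert x (underS ?W x). g y| \<le>o k"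
        using UNION_Cinfinite_bound[of "insert x (underS ?W x)" k g] g sub k by auto
      then have "|{x} \<union> (\<Union>y\<in>insert x (underS ?W x). g y)| \<le>o k"
        using k by (intro Un_Cinfinite_bound[OF one]) auto
      then show "|insert x (\<Union>y\<in>insert x (underS ?W x). g y)| \<le>o k" by simp
    qed
    then obtain s where s: "\<And>x. x \<in> Field ?W \<Longrightarrow> s x \<in> Field ?W \<and>
      insert x (\<Union>y\<in>insert x (underS ?W x). g y) \<subseteq> underS ?W (s x)" by metis
    define u where "u n = (s ^^ n) a" for n
    have uF: "u n \<in> Field ?W" for n
      by (induction n) (use a s in \<open>auto simp: u_def\<close>)
    have u_Suc: "insert (u n) (\<Union>y\<in>insert (u n) (underS ?W (u n)). g y) \<subseteq> underS ?W (u (Suc n))" for n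
      using s[OF uF[of n]] by (simp add: u_def)
    have "|range u| \<le>o natLeq" by (simp add: countable_card_le_natLeq[symmetric])
    then have "|range u| \<le>o k"
      using natLeq_ordLeq_cinfinite[OF k] ordLeq_transitive by blast
    then obtain b where "b \<in> {d \<in> Field ?W. range u \<subseteq> underS ?W d}"
      using cardSuc_bounded[OF k, of "range u"] uF by auto
    \<comment> \<open>The \<open>u n\<close> increase strictly, so the least strict upper bound
      \<open>d\<close> is their supremum and every point below \<open>d\<close> lies below some
      \<open>u n\<close>.\<close>
    then obtain d where d: "d \<in> {d \<in> Field ?W. range u \<subseteq> underS ?W d}"
      "\<And>b. b \<in> {d \<in> Field ?W. range u \<subseteq> underS ?W d} \<Longrightarrow> (d, b) \<in> ?W"
      using Well_order_least[OF W, of "{d \<in> Field ?W. range u \<subseteq> underS ?W d}"] by blast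
    have "g x \<subseteq> underS ?W d" if x: "x \<in> underS ?W d" for x
    proof -
      have xF: "x \<in> Field ?W" using x Order_Relation.underS_Field[of ?W d] by blast
      have "\<exists>n. x \<in> underS ?W (u n)"
      proof (rule ccontr)
        assume "\<nexists>n. x \<in> underS ?W (u n)"
        then have "(u (Suc n), x) \<in> ?W" for n using not_underS_iff[OF W xF uF] by blast
        then have "u n \<in> underS ?W x" for n
          using u_Suc underS_le_trans[OF W] by blast
        then have "(d, x) \<in> ?W" using d(2) xF by blast
        then show False using x not_underS_iff[OF W xF, of d] d(1) by blast
      qed
      then obtain n where "x \<in> underS ?W (u n)" by blast
      then have "g x \<subseteq> underS ?W (u (Suc n))" using u_Suc by blast
      moreover have "underS ?W (u (Suc n)) \<subseteq> underS ?W d"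
        using d(1) underS_trans[OF W] by blast
      ultimately show ?thesis by blast
    qed
    moreover have "a \<in> underS ?W d"
    proof -
      have "u 0 \<in> underS ?W d" using d(1) by blast
      then show ?thesis by (simp add: u_def)
    qed
    ultimately show ?thesis using d(1) unfolding closure_points_def by blast
  qed
  have cl: "b \<in> ?D" if b: "b \<in> Field ?W" "underS ?W b \<noteq> {}"
    "\<forall>a\<in>underS ?W b. \<exists>c\<in>?D \<inter> underS ?W b. (a, c) \<in> ?W \<and> a \<noteq> c" for b
  proof -
    have "g x \<subseteq> underS ?W b" if x: "x \<in> underS ?W b" for x
    proof -
      obtain c where c: "c \<in> ?D" "c \<in> underS ?W b" "x \<in> underS ?W c"
        using b(3) x unfolding underS_def by blast
      then have "g x \<subseteq> underS ?W c" unfolding closure_points_def by blast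
      then show ?thesis using c(2) underS_trans[OF W] by blast
    qed
    then show ?thesis using b unfolding closure_points_def by blast
  qed
  show ?thesis
    unfolding club_def
  proof (intro conjI ballI impI)
    show "?D \<subseteq> Field ?W" unfolding closure_points_def by blast
    show "\<exists>c\<in>?D. (a, c) \<in> ?W \<and> a \<noteq> c" if "a \<in> Field ?W" for a
      using unb[OF that] unfolding underS_def by blast
    show "b \<in> ?D" if "b \<in> Field ?W" "underS ?W b \<noteq> {} \<and>
      (\<forall>a\<in>underS ?W b. \<exists>c\<in>?D \<inter> underS ?W b. (a, c) \<in> ?W \<and> a \<noteq> c)" for b
      using cl that by blast
  qed
qed

section \<open>Elementary properties of clubs\<close>

lemma club_subset: "club W C \<Longrightarrow> C \<subseteq> Field W"
  unfolding club_def by (elim conjE)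

lemma stationary_meets_club: "stationary W S \<Longrightarrow> club W C \<Longrightarrow> \<exists>d\<in>S. d \<in> C"
  unfolding stationary_def by blast

lemma club_unbounded:
  assumes "club W C" "x \<in> Field W"
  shows "\<exists>y\<in>C. x \<in> underS W y"
proof -
  have "\<forall>x\<in>Field W. \<exists>y\<in>C. (x, y) \<in> W \<and> x \<noteq> y"
    using assms(1) unfolding club_def by (elim conjE)
  then show ?thesis using assms(2) unfolding underS_def by blast
qed

lemma club_closed:
  assumes "club W C" "d \<in> Field W" "underS W d \<noteq> {}"
    and "\<And>x. x \<in> underS W d \<Longrightarrow> \<exists>y\<in>C. y \<in> underS W d \<and> x \<in> underS W y"
  shows "d \<in> C"
proof -
  have cl: "\<forall>d\<in>Field W. (underS W d \<noteq> {} \<and>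
      (\<forall>a\<in>underS W d. \<exists>c\<in>C \<inter> underS W d. (a, c) \<in> W \<and> a \<noteq> c)) \<longrightarrow> d \<in> C"
    using assms(1) unfolding club_def by (elim conjE)
  have "\<forall>a\<in>underS W d. \<exists>c\<in>C \<inter> underS W d. (a, c) \<in> W \<and> a \<noteq> c"
  proof
    fix x assume "x \<in> underS W d"
    from assms(4)[OF this] obtain y where "y \<in> C" "y \<in> underS W d" "x \<in> underS W y" by blast
    then show "\<exists>c\<in>C \<inter> underS W d. (x, c) \<in> W \<and> x \<noteq> c" unfolding underS_def by blast
  qed
  with cl assms(2,3) show ?thesis by blast
qed

text \<open>The least upper bound of \<open>D\<close> is either an element of \<open>D\<close> or a
  limit of points of \<open>C\<close>, so it lies in \<open>C\<close> in both cases.\<close>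

lemma club_sup:
  assumes W: "Well_order W" and C: "club W C"
    and D: "D \<subseteq> C" "D \<noteq> {}" and u: "u \<in> Field W" "\<And>d. d \<in> D \<Longrightarrow> (d, u) \<in> W"
  obtains e where "e \<in> C" "\<And>d. d \<in> D \<Longrightarrow> (d, e) \<in> W"
    "\<And>v. v \<in> Field W \<Longrightarrow> (\<And>d. d \<in> D \<Longrightarrow> (d, v) \<in> W) \<Longrightarrow> (e, v) \<in> W"
proof -
  have DF: "D \<subseteq> Field W" using club_subset[OF C] D(1) by blast
  let ?V = "{v \<in> Field W. \<forall>d\<in>D. (d, v) \<in> W}"
  obtain e where e: "e \<in> ?V" "\<And>v. v \<in> ?V \<Longrightarrow> (e, v) \<in> W"
    using Well_order_least[OF W, of ?V] u by blast
  have "e \<in> C"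
  proof (cases "e \<in> D")
    case False
    then have De: "D \<subseteq> underS W e" using e(1) unfolding underS_def by blast
    have "\<exists>c\<in>C. c \<in> underS W e \<and> a \<in> underS W c" if a: "a \<in> underS W e" for a
    proof -
      have aF: "a \<in> Field W" using a Order_Relation.underS_Field[of W e] by blast
      have "(e, a) \<notin> W" using a not_underS_iff[OF W aF, of e] e(1) by blast
      then obtain d where d: "d \<in> D" "(d, a) \<notin> W" using e(2) aF by blast
      then have "a \<in> underS W d" using not_underS_iff[OF W aF, of d] DF by blast
      then show ?thesis using d(1) De D(1) by blast
    qed
    moreover have "underS W e \<noteq> {}" using De D(2) by blast
    ultimately show ?thesis using club_closed[OF C] e(1) by blast
  qed (use D(1) in blast)
  with e that show thesis by blast
qed

text \<open>\<open>P\<close> is unbounded below \<open>d\<close>, since its bounded parts are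
  countable; this gives a cofinal set of size \<open>omega1\<close>. A countable cofinal set would
  cover \<open>P\<close> by countably many countable pieces.\<close>

lemma ord_cof_omega1I:
  assumes W: "Well_order W" and d: "d \<in> Field W"
    and P: "P \<subseteq> underS W d" "uncountable P" "|P| \<le>o omega1"
    and bd: "\<And>y. y \<in> underS W d \<Longrightarrow> countable (P \<inter> underS W y)"
  shows "ord_cof W d omega1"
proof -
  let ?R = "Restr W (underS W d)"
  have F: "Field ?R = underS W d"
    using Refl_Field_Restr2[of W "underS W d"] W Order_Relation.underS_Field[of W d]
    unfolding order_on_defs by blast
  have UF: "underS W d \<subseteq> Field W" by (rule Order_Relation.underS_Field)
  have "\<exists>b\<in>P. (a, b) \<in> ?R" if a: "a \<in> underS W d" for a
  proof (rule ccontr)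
    assume "\<not> ?thesis"
    then have "P \<subseteq> underS W a"
      using a P(1) UF not_underS_iff[OF W, of _ a] by blast
    then have "P = P \<inter> underS W a" by blast
    with bd[OF a] P(2) show False by simp
  qed
  then have "cofinal_in ?R P" unfolding cofinal_in_def F using P(1) by blast
  moreover have "|P| =o omega1"
    using P(2,3) omega1_le_iff_uncountable ordIso_iff_ordLeq by blast
  moreover have "omega1 \<le>o |K|" if K: "cofinal_in ?R K" for K
    unfolding omega1_le_iff_uncountable
  proof
    assume cK: "countable K"
    have K': "K \<subseteq> underS W d" "\<And>a. a \<in> underS W d \<Longrightarrow> \<exists>b\<in>K. (a, b) \<in> W"
      using K unfolding cofinal_in_def F by auto
    have "P \<subseteq> K \<union> (\<Union>y\<in>K. P \<inter> underS W y)"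
    proof
      fix x assume x: "x \<in> P"
      then obtain b where "b \<in> K" "(x, b) \<in> W" using K'(2) P(1) by blast
      then show "x \<in> K \<union> (\<Union>y\<in>K. P \<inter> underS W y)" using x unfolding underS_def by blast
    qed
    moreover have "countable (\<Union>y\<in>K. P \<inter> underS W y)"
    proof (rule countable_UN[OF cK])
      show "countable (P \<inter> underS W y)" if "y \<in> K" for y using bd that K'(1) by blast
    qed
    ultimately have "countable P" using cK by (meson countable_Un countable_subset)
    with P(2) show False by blast
  qed
  ultimately show ?thesis unfolding ord_cof_def has_cof_def by blast
qed

text \<open>The pieces are proper initial segments given by a countable cofinal set, so they are
  smaller than the cardinal \<open>r\<close>.\<close>

lemma has_cof_natLeq_cover:
  fixes r :: "'a rel"
  assumes r: "Cinfinite r" and cof: "has_cof r natLeq"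
  shows "\<exists>(K :: 'a set) H. countable K \<and> Field r = (\<Union>b\<in>K. H b) \<and> (\<forall>b\<in>K. |H b| <o r)"
proof -
  have W: "Well_order r" using r Card_order_Well_order by blast
  obtain K where K: "cofinal_in r K" "|K| =o natLeq" using cof unfolding has_cof_def by blast
  \<comment> \<open>The strict segment below \<open>b\<close> misses \<open>b\<close> itself, so
    each element of \<open>K\<close> is replaced by a larger one.\<close>
  have "\<forall>b\<in>K. \<exists>b'. b' \<in> Field r \<and> b \<in> underS r b'"
    using Card_order_limit[OF r] K(1) unfolding cofinal_in_def by blast
  then obtain s where s: "\<And>b. b \<in> K \<Longrightarrow> s b \<in> Field r \<and> b \<in> underS r (s b)" by metis
  show ?thesis
  proof (intro exI[of _ K] exI[of _ "\<lambda>b. underS r (s b)"] conjI ballI)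
    show "countable K" using K(2) by (simp add: countable_card_le_natLeq ordIso_imp_ordLeq)
    show "|underS r (s b)| <o r" if "b \<in> K" for b
      using card_of_underS[of r "s b"] r s[OF that] by blast
    show "Field r = (\<Union>b\<in>K. underS r (s b))"
    proof
      show "(\<Union>b\<in>K. underS r (s b)) \<subseteq> Field r" using Order_Relation.underS_Field by fast
      show "Field r \<subseteq> (\<Union>b\<in>K. underS r (s b))"
      proof
        fix x assume "x \<in> Field r"
        then obtain b where "b \<in> K" "(x, b) \<in> r" using K(1) unfolding cofinal_in_def by blast
        then show "x \<in> (\<Union>b\<in>K. underS r (s b))" using s le_underS_trans[OF W] by blast
      qed
    qed
  qed
qed

text \<open>
  The map \<open>c\<close> is meant to enumerate the countable subsets of \<open>Field W\<close> in order type \<open>W\<close>.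
\<close>
definition free_of :: "'a rel \<Rightarrow> ('a \<Rightarrow> 'a set) \<Rightarrow> 'a \<Rightarrow> 'a set \<Rightarrow> bool" where
  "free_of W c d A \<longleftrightarrow> uncountable A \<and> |A| \<le>o omega1 \<and> (\<forall>x\<in>underS W d. finite (A \<inter> c x))"

definition bad_points :: "'a rel \<Rightarrow> ('a \<Rightarrow> 'a set) \<Rightarrow> 'a set" where
  "bad_points W c = {d \<in> E_omega1 W. \<exists>A\<subseteq>underS W d. free_of W c d A}"

section \<open>Nonstationary bad points\<close>

lemma infinite_csubE:
  assumes "infinite U"
  obtains X where "X \<in> csub U" "infinite X"
  using infinite_countable_subset'[OF assms] unfolding csub_def by blast

lemma csub_weaken: "X \<in> csub A \<Longrightarrow> A \<subseteq> B \<Longrightarrow> X \<in> csub B"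
  unfolding csub_def by blast

lemma csub_subsetD: "X \<in> csub A \<Longrightarrow> X \<subseteq> A"
  unfolding csub_def by blast

text \<open>A smaller set of any type has a copy inside \<open>M\<close>, so a bound known for
  subsets of \<open>M\<close> carries over.\<close>

lemma csub_le_if_less:
  assumes "\<And>U. U \<subseteq> M \<Longrightarrow> |U| <o |M| \<Longrightarrow> |csub U| \<le>o |M|" and V: "|V| <o |M|"
  shows "|csub V| \<le>o |M|"
proof -
  obtain U where U: "U \<subset> Field |M|" "|V| =o |U|" "|U| <o |M|"
    using V internalize_card_of_ordLess[of V "|M|"] by blast
  then have "|csub U| \<le>o |M|" using assms(1) by (simp add: Field_card_of psubset_imp_subset)
  with csub_mono[OF ordIso_imp_ordLeq[OF U(2)]] show ?thesis by (rule ordLeq_transitive)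
qed

lemma less_if_countable:
  assumes "omega1 \<le>o |M|" "countable V"
  shows "|V| <o |M|"
  using assms ordLess_ordLeq_trans unfolding countable_iff_less_omega1 by blast

lemma card_of_image_le: "|A| \<le>o r \<Longrightarrow> |f ` A| \<le>o r"
  by (rule ordLeq_transitive[OF card_of_image])

text \<open>The preimages of the \<open>H b\<close> under an injection into \<open>M\<close> form
  the cover. The index set stays the same, so one countable \<open>K\<close> serves all initial
  segments.\<close>

lemma small_cover_transfer:
  fixes M :: "'m set"
  assumes M: "Cinfinite |M|" and P: "|U| \<le>o |M|"
    and cover: "countable K" "M = (\<Union>b\<in>K. H b)"
  shows "\<exists>G. U = (\<Union>b\<in>K. G b) \<and> (\<forall>b\<in>K. |G b| \<le>o |H b| )"
proof -
  obtain i where i: "inj_on i U" "i ` U \<subseteq> M" using P unfolding card_of_ordLeq[symmetric] by blast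
  have "U = (\<Union>b\<in>K. {x \<in> U. i x \<in> H b})" using i(2) cover(2) by auto
  moreover have "|{x \<in> U. i x \<in> H b}| \<le>o |H b|" for b
    unfolding card_of_ordLeq[symmetric]
    by (rule exI[of _ i]) (use i(1) in \<open>auto simp: inj_on_def\<close>)
  ultimately show ?thesis by (intro exI[of _ "\<lambda>b. {x \<in> U. i x \<in> H b}"]) auto
qed

text \<open>Members are numbered by \<open>e\<close> and points by \<open>p\<close>, both in
  \<open>W\<close>. The rank of a member is the first point above its number in a club
  \<open>D\<close> of closure points free of bad points. The fact \<open>main\<close> is the core: a
  member numbered at or above \<open>d\<close> has countable trace below \<open>d\<close>, since an
  uncountable one would make \<open>d\<close> bad.\<close>

lemma essentially_disjoint_if_not_stationary:
  fixes \<A> :: "'b set set" and M :: "'m set"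
  defines "W \<equiv> cardSuc |M|"
  assumes ad: "almost_disjoint_family \<A>" and le: "|\<A>| \<le>o W"
    and M: "omega1 \<le>o |M|" and cof: "has_cof |M| natLeq"
    and small: "\<And>U. U \<subseteq> M \<Longrightarrow> |U| <o |M| \<Longrightarrow> |csub U| \<le>o |M|"
    and c: "c ` Field W = csub (Field W)"
    and nonstat: "\<not> stationary W (bad_points W c)"
    and IH: "\<And>\<B>. \<B> \<subseteq> \<A> \<Longrightarrow> |\<B>| \<le>o |M| \<Longrightarrow> essentially_disjoint \<B> omega1"
  shows "essentially_disjoint \<A> omega1"
proof -
  have Minf: "infinite M" using M omega1_le_iff_uncountable countable_finite by blast
  have k: "Cinfinite |M|" using Cinfinite_card_of[OF Minf] .
  have CW: "Cinfinite W" unfolding W_def using Cinfinite_cardSuc[OF k] .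
  then have W: "Well_order W" using Card_order_Well_order by blast
  have MW: "|M| \<le>o W" unfolding W_def using cardSuc_ordLeq card_of_Card_order by blast
  have WF: "W \<le>o |Field W|" using CW card_of_Field_ordIso ordIso_imp_ordLeq ordIso_symmetric by blast
  have UF: "underS W d \<subseteq> Field W" for d by (rule Order_Relation.underS_Field)
  have leF: "|X| \<le>o |Field W|" if "|X| \<le>o W" for X :: "'x set"
    using that WF ordLeq_transitive by blast
  have csub_small: "|csub V| \<le>o |M|" if "|V| <o |M|" for V :: "'x set"
    by (rule csub_le_if_less[OF small that])
  obtain e where e: "inj_on e \<A>" "e ` \<A> \<subseteq> Field W"
    using leF[OF le] unfolding card_of_ordLeq[symmetric] by blast
  have "|\<Union>A\<in>\<A>. A| \<le>o W"
  proof (rule UNION_Cinfinite_bound[OF le _ CW], rule ballI)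
    fix A assume "A \<in> \<A>"
    then have "|A| \<le>o omega1" using ad unfolding almost_disjoint_family_def by blast
    then show "|A| \<le>o W" using ordLeq_transitive[OF M MW] by (rule ordLeq_transitive)
  qed
  then obtain p where p: "inj_on p (\<Union>\<A>)" "p ` \<Union>\<A> \<subseteq> Field W"
    using leF[of "\<Union>\<A>"] unfolding card_of_ordLeq[symmetric] by auto
  have bad_sub: "bad_points W c \<subseteq> Field W" unfolding bad_points_def E_omega1_def by blast
  obtain C where C: "club W C" "bad_points W c \<inter> C = {}"
    using nonstat bad_sub unfolding stationary_def by blast
  obtain K :: "'m set" and H where
    KH: "countable K" "M = (\<Union>b\<in>K. H b)" "\<forall>b\<in>K. |H b| <o |M|"
    using has_cof_natLeq_cover[OF k cof] unfolding Field_card_of by (elim exE conjE)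
  have "\<exists>G. underS W y = (\<Union>b\<in>K. G b) \<and> (\<forall>b\<in>K. |G b| \<le>o |H b| )" if "y \<in> Field W" for y
    by (rule small_cover_transfer[OF k _ KH(1,2)])
      (use that underS_cardSuc_le[OF card_of_Card_order] in \<open>simp add: W_def\<close>)
  then obtain G where G: "\<And>y. y \<in> Field W \<Longrightarrow> underS W y = (\<Union>b\<in>K. G y b)"
    "\<And>y b. y \<in> Field W \<Longrightarrow> b \<in> K \<Longrightarrow> |G y b| \<le>o |H b|" by metis
  define idx where "idx = inv_into (Field W) c"
  have idx: "idx X \<in> Field W" "c (idx X) = X" if "X \<in> csub (Field W)" for X
    unfolding idx_def using that c inv_into_into f_inv_into_f by metis+
  have "\<forall>x\<in>Field W. \<exists>z. z \<in> C \<and> x \<in> underS W z"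
    using club_unbounded[OF C(1)] by blast
  then obtain z where z: "\<And>x. x \<in> Field W \<Longrightarrow> z x \<in> C \<and> x \<in> underS W (z x)" by metis
  \<comment> \<open>Closure of \<open>d\<close> under \<open>g1\<close> keeps members numbered below
    \<open>d\<close> inside \<open>d\<close>; under \<open>g2\<close> it gives numbers below
    \<open>d\<close> to the members with infinite trace on some earlier \<open>c x\<close>. The map
    \<open>z\<close> makes \<open>d\<close> a limit of points of \<open>C\<close>.\<close>
  define g1 where "g1 x = (if x \<in> e ` \<A> then p ` inv_into \<A> e x else {})" for x
  define g2 where "g2 x = e ` {A \<in> \<A>. infinite (A \<inter> {a \<in> \<Union>\<A>. p a \<in> c x})}" for x
  \<comment> \<open>Only countable subsets of the pieces \<open>G x b\<close> get their indices
    below \<open>d\<close>. A whole initial segment of size \<open>|M|\<close> has more than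
    \<open>|M|\<close> countable subsets, too many for a closure argument.\<close>
  define g3 where "g3 x = idx ` (\<Union>b\<in>K. csub (G x b))" for x
  define g where "g x = (g1 x \<union> g2 x) \<union> (g3 x \<union> {z x})" for x
  have g: "g x \<subseteq> Field W \<and> |g x| \<le>o |M|" if x: "x \<in> Field W" for x
  proof -
    have g1: "g1 x \<subseteq> Field W \<and> |g1 x| \<le>o |M|"
    proof (cases "x \<in> e ` \<A>")
      case True
      then have A: "inv_into \<A> e x \<in> \<A>" by (rule inv_into_into)
      then have "|inv_into \<A> e x| \<le>o |M|"
        using ad M ordLeq_transitive unfolding almost_disjoint_family_def by blast
      moreover have "p ` inv_into \<A> e x \<subseteq> Field W" using A p(2) by blast
      ultimately show ?thesis using True card_of_image_le unfolding g1_def by auto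
    qed (simp add: g1_def card_of_empty)
    have "c x \<in> csub (Field W)" using c x by blast
    then have "countable (c x)" unfolding csub_def by blast
    moreover have "inj_on p {a \<in> \<Union>\<A>. p a \<in> c x}" by (rule inj_on_subset[OF p(1)]) blast
    ultimately have "countable {a \<in> \<Union>\<A>. p a \<in> c x}"
      by (auto intro: countable_image_inj_on countable_subset[of _ "c x"])
    then have "|csub {a \<in> \<Union>\<A>. p a \<in> c x}| \<le>o |M|"
      using csub_small less_if_countable[OF M] by blast
    then have "|{A \<in> \<A>. infinite (A \<inter> {a \<in> \<Union>\<A>. p a \<in> c x})}| \<le>o |M|"
      by (rule ordLeq_transitive[OF infinite_traces_le[OF ad]])
    then have g2: "g2 x \<subseteq> Field W \<and> |g2 x| \<le>o |M|"
      using e(2) card_of_image_le unfolding g2_def by auto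
    have Gx: "csub (G x b) \<subseteq> csub (Field W)" if "b \<in> K" for b
    proof -
      have "G x b \<subseteq> Field W" using G(1)[OF x] UF[of x] that by blast
      then show ?thesis unfolding csub_def by blast
    qed
    have "|csub (G x b)| \<le>o |M|" if "b \<in> K" for b
      using csub_small ordLeq_ordLess_trans[OF G(2)[OF x that] bspec[OF KH(3) that]] by blast
    moreover have "|K| \<le>o |M|" using less_if_countable[OF M KH(1)] ordLess_imp_ordLeq by blast
    ultimately have "|\<Union>b\<in>K. csub (G x b)| \<le>o |M|"
      by (intro card_of_UNION_ordLeq_infinite[OF Minf] ballI)
    moreover have "g3 x \<subseteq> Field W" unfolding g3_def using idx(1) Gx by blast
    ultimately have g3: "g3 x \<subseteq> Field W \<and> |g3 x| \<le>o |M|"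
      unfolding g3_def by (intro conjI card_of_image_le)
    have g4: "{z x} \<subseteq> Field W \<and> |{z x}| \<le>o |M|"
      using subsetD[OF club_subset[OF C(1)]] z[OF x]
      by (simp add: card_of_singl_ordLeq[OF infinite_imp_nonempty[OF Minf]])
    have "|g x| \<le>o |M|"
      unfolding g_def using g1 g2 g3 g4 by (intro Un_Cinfinite_bound k) auto
    then show ?thesis using g1 g2 g3 g4 unfolding g_def by blast
  qed
  define D where "D = closure_points W g"
  have D: "club W D" unfolding D_def W_def
    by (rule club_closure_points[OF k]) (use g in \<open>simp add: W_def\<close>)
  have DF: "D \<subseteq> Field W" by (rule club_subset[OF D])
  have Dg: "g x \<subseteq> underS W d" if "d \<in> D" "x \<in> underS W d" for x d
    using that unfolding D_def closure_points_def by blast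
  have DC: "D \<subseteq> C"
  proof
    fix d assume d: "d \<in> D"
    have "\<exists>y\<in>C. y \<in> underS W d \<and> a \<in> underS W y" if a: "a \<in> underS W d" for a
    proof -
      have "z a \<in> underS W d" using Dg[OF d a] unfolding g_def by blast
      moreover have "z a \<in> C \<and> a \<in> underS W (z a)" using z a UF[of d] by blast
      ultimately show ?thesis by blast
    qed
    moreover have "underS W d \<noteq> {}" "d \<in> Field W"
      using d unfolding D_def closure_points_def by auto
    ultimately show "d \<in> C" using club_closed[OF C(1)] by blast
  qed
  have D1: "p ` A \<subseteq> underS W d" if "d \<in> D" "A \<in> \<A>" "e A \<in> underS W d" for d A
    using Dg[OF that(1,3)] that(2) e(1) unfolding g_def g1_def by auto
  have main: "countable (p ` A \<inter> underS W d)"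
    if d: "d \<in> D" and A: "A \<in> \<A>" "e A \<notin> underS W d" for d A
  proof (rule ccontr)
    let ?P = "p ` A \<inter> underS W d"
    assume unc: "uncountable ?P"
    have "|A| \<le>o omega1" using ad A(1) unfolding almost_disjoint_family_def by blast
    then have P_le: "|?P| \<le>o omega1"
      using card_of_image_le card_of_mono1[of ?P "p ` A"] ordLeq_transitive by blast
    have fin: "finite (?P \<inter> c x)" if x: "x \<in> underS W d" for x
    proof -
      have "finite (A \<inter> {a \<in> \<Union>\<A>. p a \<in> c x})"
        using A Dg[OF d x] unfolding g_def g2_def by blast
      then have "finite (p ` (A \<inter> {a \<in> \<Union>\<A>. p a \<in> c x}))" by simp
      moreover have "?P \<inter> c x \<subseteq> p ` (A \<inter> {a \<in> \<Union>\<A>. p a \<in> c x})" using A(1) by auto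
      ultimately show ?thesis using finite_subset by blast
    qed
    have "countable (?P \<inter> underS W y)" if y: "y \<in> underS W d" for y
    proof -
      have yF: "y \<in> Field W" using y UF[of d] by blast
      \<comment> \<open>An infinite intersection would contain a countably infinite \<open>X\<close>
        listed before \<open>d\<close>, contradicting \<open>fin\<close>. Thus \<open>?P\<close>
        below \<open>y\<close> is a countable union of finite sets, and \<open>d\<close> has
        cofinality \<open>omega1\<close>.\<close>
      have "finite (?P \<inter> G y b)" if b: "b \<in> K" for b
      proof (rule ccontr)
        assume "infinite (?P \<inter> G y b)"
        then obtain X where X: "X \<in> csub (?P \<inter> G y b)" "infinite X"
          using infinite_csubE by blast
        have "X \<in> csub (G y b)" by (rule csub_weaken[OF X(1)]) simp
        then have "idx X \<in> underS W d" using Dg[OF d y] b unfolding g_def g3_def by blast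
        then have "finite (?P \<inter> c (idx X))" by (rule fin)
        moreover have "X \<in> csub (Field W)" by (rule csub_weaken[OF X(1)]) (use UF[of d] in auto)
        then have "c (idx X) = X" by (rule idx(2))
        moreover have "?P \<inter> X = X" using csub_subsetD[OF X(1)] by auto
        ultimately show False using X(2) by simp
      qed
      then have "countable (\<Union>b\<in>K. ?P \<inter> G y b)"
        by (intro countable_UN[OF KH(1)] countable_finite)
      moreover have "?P \<inter> underS W y = (\<Union>b\<in>K. ?P \<inter> G y b)" using G(1)[OF yF] by auto
      ultimately show ?thesis by simp
    qed
    moreover have dF: "d \<in> Field W" using d DF by blast
    ultimately have "ord_cof W d omega1"
      using ord_cof_omega1I[OF W dF _ unc P_le] by blast
    then have "d \<in> bad_points W c"
      unfolding bad_points_def E_omega1_def free_of_def using dF unc P_le fin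
      by (intro CollectI conjI exI[of _ ?P]) auto
    then show False using C(2) DC d by blast
  qed
  have "\<exists>m. m \<in> D \<and> e A \<in> underS W m \<and> (\<forall>d\<in>D. e A \<in> underS W d \<longrightarrow> (m, d) \<in> W)"
    if A: "A \<in> \<A>" for A
  proof -
    have "{d \<in> D. e A \<in> underS W d} \<noteq> {}"
      using club_unbounded[OF D, of "e A"] e(2) A by blast
    then obtain m where "m \<in> {d \<in> D. e A \<in> underS W d}"
      "\<And>d. d \<in> {d \<in> D. e A \<in> underS W d} \<Longrightarrow> (m, d) \<in> W"
      using Well_order_least[OF W, of "{d \<in> D. e A \<in> underS W d}"] DF by blast
    then show ?thesis by blast
  qed
  then obtain r where r: "\<And>A. A \<in> \<A> \<Longrightarrow> r A \<in> D" "\<And>A. A \<in> \<A> \<Longrightarrow> e A \<in> underS W (r A)"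
    "\<And>A d. A \<in> \<A> \<Longrightarrow> d \<in> D \<Longrightarrow> e A \<in> underS W d \<Longrightarrow> (r A, d) \<in> W" by metis
  show ?thesis
  proof (rule essentially_disjoint_by_rank[where r = r and R = "W - Id"])
    fix A B assume "A \<in> \<A>" "B \<in> \<A>"
    then have "r A \<in> Field W" "r B \<in> Field W" using r(1) DF by auto
    then show "r A = r B \<or> (r A, r B) \<in> W - Id \<or> (r B, r A) \<in> W - Id"
      using W unfolding order_on_defs total_on_def by blast
  next
    fix A assume A: "A \<in> \<A>"
    let ?B = "{B \<in> \<A>. r B = r A}"
    have "e ` ?B \<subseteq> underS W (r A)" using r(2) by force
    moreover have "inj_on e ?B" using e(1) by (rule inj_on_subset) blast
    ultimately have "|?B| \<le>o |underS W (r A)|" unfolding card_of_ordLeq[symmetric] by blast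
    moreover have "|underS W (r A)| \<le>o |M|"
      using underS_cardSuc_le[OF card_of_Card_order] r(1)[OF A] DF unfolding W_def by blast
    ultimately have "|?B| \<le>o |M|" by (rule ordLeq_transitive)
    then show "essentially_disjoint ?B omega1" by (rule IH[rotated]) simp
  next
    fix A assume A: "A \<in> \<A>"
    let ?U = "{B \<in> \<A>. (r B, r A) \<in> W - Id}"
    show "countable (A \<inter> \<Union>?U)"
    proof (cases "?U = {}")
      case True
      then show ?thesis by (simp only: Union_empty Int_empty_right countable_empty)
    next
      case False
      let ?D = "{d \<in> D. d \<in> underS W (r A)}"
      have rU: "r B \<in> ?D" if "B \<in> ?U" for B using that r(1) unfolding underS_def by blast
      have eA: "e A \<in> Field W" using e(2) A by blast
      have D_le: "(d, e A) \<in> W" if "d \<in> ?D" for d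
      proof (rule ccontr)
        assume "(d, e A) \<notin> W"
        then have "e A \<in> underS W d" using not_underS_iff[OF W eA, of d] that DF by blast
        then have "(r A, d) \<in> W" using r(3)[OF A] that by blast
        then show False using that not_underS_iff[OF W, of d "r A"] DF r(1)[OF A] by blast
      qed
      \<comment> \<open>\<open>main\<close> cannot be applied at \<open>r A\<close>, which lies
        above \<open>e A\<close>. The supremum \<open>s\<close> of the earlier points of
        \<open>D\<close> is still at most \<open>e A\<close>, and every member of smaller rank has
        its points below \<open>s\<close>.\<close>
      obtain s where s: "s \<in> D" "\<And>d. d \<in> ?D \<Longrightarrow> (d, s) \<in> W"
        "\<And>v. v \<in> Field W \<Longrightarrow> (\<And>d. d \<in> ?D \<Longrightarrow> (d, v) \<in> W) \<Longrightarrow> (s, v) \<in> W"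
      proof (rule club_sup[OF W D, of ?D "e A"])
        show "?D \<noteq> {}" using rU False by blast
      qed (use eA D_le in auto)
      have "e A \<notin> underS W s"
        using s(3)[OF eA D_le] not_underS_iff[OF W eA, of s] s(1) DF by blast
      then have cnt: "countable (p ` A \<inter> underS W s)" using main[OF s(1) A] by blast
      have "p ` (A \<inter> \<Union>?U) \<subseteq> p ` A \<inter> underS W s"
      proof
        fix y assume "y \<in> p ` (A \<inter> \<Union>?U)"
        then obtain x B where x: "y = p x" "x \<in> A" "B \<in> ?U" "x \<in> B" by blast
        then have B: "B \<in> \<A>" by blast
        have "y \<in> underS W (r B)" using D1[OF r(1)[OF B] B r(2)[OF B]] x by blast
        then have "y \<in> underS W s" using s(2)[OF rU[OF x(3)]] underS_le_trans[OF W] by blast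
        then show "y \<in> p ` A \<inter> underS W s" using x by blast
      qed
      then have "countable (p ` (A \<inter> \<Union>?U))" by (rule countable_subset[OF _ cnt])
      moreover have "A \<inter> \<Union>?U \<subseteq> \<Union>\<A>" using A by auto
      then have "inj_on p (A \<inter> \<Union>?U)" by (rule inj_on_subset[OF p(1)])
      ultimately show ?thesis by (rule countable_image_inj_on)
    qed
  qed
qed

section \<open>Stationary bad points\<close>

text \<open>The sets \<open>B d\<close> are fixed before any colouring is given. For a colouring it
  then suffices to find one \<open>d\<close> at which the guess is the trace of a colour class and
  contains some free set: the chosen \<open>B d\<close> lies in the same guess.\<close>

lemma monochromatic_if_stationary:
  fixes M :: "'m set"
  defines "W \<equiv> cardSuc |M|"
  assumes M: "omega1 \<le>o |M|"
    and small: "\<And>U. U \<subseteq> Field W \<Longrightarrow> |U| \<le>o omega1 \<Longrightarrow> |csub U| \<le>o |M|"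
    and c: "c ` Field W = csub (Field W)"
    and diamond: "diamond W (bad_points W c)"
  obtains \<B> where "|\<B>| \<le>o W" "\<And>B. B \<in> \<B> \<Longrightarrow> B \<subseteq> Field W \<and> |B| =o omega1"
    "\<And>B B'. B \<in> \<B> \<Longrightarrow> B' \<in> \<B> \<Longrightarrow> B \<noteq> B' \<Longrightarrow> finite (B \<inter> B')"
    "\<And>f :: 'm set \<Rightarrow> 'c. |f ` Field W| \<le>o omega1 \<Longrightarrow> \<exists>B\<in>\<B>. \<forall>x\<in>B. \<forall>y\<in>B. f x = f y"
proof -
  have Minf: "infinite M" using M omega1_le_iff_uncountable countable_finite by blast
  have k: "Cinfinite |M|" using Cinfinite_card_of[OF Minf] .
  have CW: "Cinfinite W" unfolding W_def using Cinfinite_cardSuc[OF k] .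
  then have W: "Well_order W" using Card_order_Well_order by blast
  have UF: "underS W d \<subseteq> Field W" for d by (rule Order_Relation.underS_Field)
  let ?S = "bad_points W c"
  have SF: "?S \<subseteq> Field W" unfolding bad_points_def E_omega1_def by blast
  obtain G where G: "\<forall>d\<in>?S. G d \<subseteq> underS W d"
    "\<forall>X. X \<subseteq> Field W \<longrightarrow> stationary W {d \<in> ?S. X \<inter> underS W d = G d}"
    using diamond unfolding diamond_def by (elim exE conjE)
  define idx where "idx = inv_into (Field W) c"
  have idx: "idx X \<in> Field W" "c (idx X) = X" if "X \<in> csub (Field W)" for X
    unfolding idx_def using that c inv_into_into f_inv_into_f by metis+
  let ?P = "\<lambda>d B. B \<subseteq> G d \<and> free_of W c d B"
  define S1 where "S1 = {d \<in> ?S. \<exists>B. ?P d B}"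
  define B where "B d = (SOME B. ?P d B)" for d
  have B: "B d \<subseteq> G d" "free_of W c d (B d)" if "d \<in> S1" for d
    using that someI_ex[of "?P d"] unfolding S1_def B_def by auto
  have BU: "B d \<subseteq> underS W d" if "d \<in> S1" for d
    using B(1)[OF that] G(1) that unfolding S1_def by blast
  have BF: "B d \<subseteq> Field W" if "d \<in> S1" for d using BU[OF that] UF by (rule subset_trans)
  \<comment> \<open>Closure under \<open>g1\<close> lists all countable subsets of an earlier
    \<open>B x\<close> before \<open>d\<close>. As \<open>B d\<close> is free of them, it meets
    \<open>B x\<close> in a finite set.\<close>
  define g1 where "g1 x = (if x \<in> S1 then idx ` csub (B x) else {})" for x
  have g1: "g1 x \<subseteq> Field W \<and> |g1 x| \<le>o |M|" for x
  proof (cases "x \<in> S1")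
    case True
    have "|csub (B x)| \<le>o |M|"
      using small[OF BF[OF True]] B(2)[OF True] unfolding free_of_def by blast
    moreover have "idx ` csub (B x) \<subseteq> Field W"
      using idx(1) csub_weaken[OF _ BF[OF True]] by (intro image_subsetI) blast
    ultimately show ?thesis using True card_of_image_le unfolding g1_def by simp
  qed (simp add: g1_def card_of_empty)
  define S2 where "S2 = S1 \<inter> closure_points W g1"
  have S2F: "S2 \<subseteq> Field W" unfolding S2_def closure_points_def by blast
  have ad_aux: "finite (B a \<inter> B b)" if a: "a \<in> S2" and b: "b \<in> S2" and ab: "b \<in> underS W a" for a b
  proof (rule ccontr)
    assume "infinite (B a \<inter> B b)"
    then obtain X where X: "X \<in> csub (B a \<inter> B b)" "infinite X" by (rule infinite_csubE)
    have "X \<in> csub (B b)" by (rule csub_weaken[OF X(1)]) simp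
    moreover have "g1 b \<subseteq> underS W a" using a ab unfolding S2_def closure_points_def by blast
    ultimately have "idx X \<in> underS W a" using b unfolding g1_def S2_def by auto
    then have "finite (B a \<inter> c (idx X))"
      using B(2)[of a] a unfolding free_of_def S2_def by blast
    moreover have "X \<in> csub (Field W)" by (rule csub_weaken[OF X(1)]) (use BF[of a] a S2_def in auto)
    then have "c (idx X) = X" by (rule idx(2))
    moreover have "B a \<inter> X = X" using csub_subsetD[OF X(1)] by auto
    ultimately show False using X(2) by simp
  qed
  have ad: "finite (B a \<inter> B b)" if "a \<in> S2" "b \<in> S2" "a \<noteq> b" for a b
  proof -
    have "a \<in> Field W" "b \<in> Field W" using that S2F by auto
    then have "a \<in> underS W b \<or> b \<in> underS W a"
      using not_underS_iff[OF W, of a b] that(3) unfolding underS_def by blast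
    then show ?thesis using ad_aux that by (metis Int_commute)
  qed
  show thesis
  proof
    have "|S2| \<le>o |Field W|" using S2F by (rule card_of_mono1)
    then have "|S2| \<le>o W" using card_of_Field_ordIso CW ordLeq_ordIso_trans by blast
    then show "|B ` S2| \<le>o W" by (rule card_of_image_le)
    show "C \<subseteq> Field W \<and> |C| =o omega1" if C: "C \<in> B ` S2" for C
    proof -
      obtain d where d: "d \<in> S1" "C = B d" using C unfolding S2_def by blast
      then show ?thesis
        using BF[OF d(1)] B(2)[OF d(1)]
        by (simp add: free_of_def ordIso_iff_ordLeq omega1_le_iff_uncountable)
    qed
    show "finite (C \<inter> C')" if "C \<in> B ` S2" "C' \<in> B ` S2" "C \<noteq> C'" for C C'
      using ad that by auto
    show "\<exists>C\<in>B ` S2. \<forall>x\<in>C. \<forall>y\<in>C. f x = f y" if f: "|f ` Field W| \<le>o omega1"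
      for f :: "'m set \<Rightarrow> 'c"
    proof -
      \<comment> \<open>Pigeonhole: at most \<open>|M|\<close> classes of size at most
        \<open>|M|\<close> cannot cover a successor cardinal.\<close>
      have "\<exists>i\<in>f ` Field W. \<not> |{x \<in> Field W. f x = i}| \<le>o |M|"
      proof (rule ccontr)
        assume neg: "\<not> ?thesis"
        have "|f ` Field W| \<le>o |M|" using f M by (rule ordLeq_transitive)
        then have "|\<Union>i\<in>f ` Field W. {x \<in> Field W. f x = i}| \<le>o |M|"
          by (rule card_of_UNION_ordLeq_infinite[OF Minf]) (use neg in blast)
        moreover have "(\<Union>i\<in>f ` Field W. {x \<in> Field W. f x = i}) = Field W" by auto
        ultimately have "|Field W| \<le>o |M|" by simp
        moreover have "W =o |Field W|" using card_of_Field_ordIso CW ordIso_symmetric by blast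
        ultimately have "W \<le>o |M|" by (rule ordIso_ordLeq_trans[rotated])
        then show False
          using cardSuc_greater[OF card_of_Card_order] not_ordLess_ordLeq unfolding W_def by blast
      qed
      then obtain i where i: "\<not> |{x \<in> Field W. f x = i}| \<le>o |M|" by blast
      let ?X = "{x \<in> Field W. f x = i}"
      have "|M| <o |?X|" using i not_ordLeq_iff_ordLess[OF card_of_Well_order card_of_Well_order] by (rule iffD1[rotated])
      then have "W \<le>o |?X|" unfolding W_def by (rule cardSuc_least[OF card_of_Card_order card_of_Card_order])
      then have "|Field W| \<le>o |?X|" using card_of_Field_ordIso CW ordIso_ordLeq_trans by blast
      then obtain h where h: "inj_on h (Field W)" "h ` Field W \<subseteq> ?X"
        unfolding card_of_ordLeq[symmetric] by blast
      have hF: "h x \<in> Field W" "f (h x) = i" if "x \<in> Field W" for x using h(2) that by auto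
      define g2 where "g2 x = {h x, idx {a \<in> Field W. h a \<in> c x}}" for x
      have inv: "{a \<in> Field W. h a \<in> c x} \<in> csub (Field W)" if x: "x \<in> Field W" for x
      proof -
        have "c x \<in> csub (Field W)" using c x by blast
        then have "countable (c x)" unfolding csub_def by blast
        moreover have "inj_on h {a \<in> Field W. h a \<in> c x}" by (rule inj_on_subset[OF h(1)]) blast
        ultimately have "countable {a \<in> Field W. h a \<in> c x}"
          by (auto intro: countable_image_inj_on countable_subset[of _ "c x"])
        then show ?thesis unfolding csub_def by blast
      qed
      have g2: "g2 x \<subseteq> Field W \<and> |g2 x| \<le>o |M|" if x: "x \<in> Field W" for x
      proof -
        have "countable (g2 x)" unfolding g2_def by simp
        then have "|g2 x| \<le>o |M|" using less_if_countable[OF M] ordLess_imp_ordLeq by blast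
        moreover have "g2 x \<subseteq> Field W"
          unfolding g2_def using hF(1)[OF x] idx(1)[OF inv[OF x]] by simp
        ultimately show ?thesis by simp
      qed
      \<comment> \<open>\<open>g1\<close> is included so that the point found below belongs to
        \<open>S2\<close>.\<close>
      define D where "D = closure_points W (\<lambda>x. g1 x \<union> g2 x)"
      have D: "club W D" unfolding D_def W_def
      proof (rule club_closure_points[OF k])
        fix x assume "x \<in> Field (cardSuc |M| )"
        then have "g2 x \<subseteq> Field W \<and> |g2 x| \<le>o |M|" using g2 unfolding W_def by blast
        then show "g1 x \<union> g2 x \<subseteq> Field (cardSuc |M| ) \<and> |g1 x \<union> g2 x| \<le>o |M|"
          using g1[of x] unfolding W_def by (intro conjI Un_Cinfinite_bound[OF _ _ k]) simp_all
      qed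
      have "stationary W {d \<in> ?S. ?X \<inter> underS W d = G d}" by (rule G(2)[rule_format]) blast
      from stationary_meets_club[OF this D]
      obtain d where d: "d \<in> ?S" "?X \<inter> underS W d = G d" "d \<in> D" by blast
      have Dg: "g1 x \<union> g2 x \<subseteq> underS W d" if "x \<in> underS W d" for x
        using d(3) that unfolding D_def closure_points_def by blast
      obtain A where A: "A \<subseteq> underS W d" "free_of W c d A"
        using d(1) unfolding bad_points_def by blast
      have AF: "A \<subseteq> Field W" using A(1) UF by (rule subset_trans)
      have hA: "inj_on h A" using h(1) AF by (rule inj_on_subset)
      have "h ` A \<subseteq> G d"
      proof
        fix y assume "y \<in> h ` A"
        then obtain a where a: "a \<in> A" "y = h a" by blast
        then have "h a \<in> underS W d" using Dg[of a] A(1) unfolding g2_def by blast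
        then show "y \<in> G d" using hF[of a] a AF d(2) by blast
      qed
      moreover have "free_of W c d (h ` A)"
        unfolding free_of_def
      proof (intro conjI ballI)
        show "uncountable (h ` A)"
          using A(2) countable_image_inj_on[OF _ hA] unfolding free_of_def by blast
        show "|h ` A| \<le>o omega1" using A(2) card_of_image_le unfolding free_of_def by blast
        fix x assume x: "x \<in> underS W d"
        let ?c = "{a \<in> Field W. h a \<in> c x}"
        have "idx ?c \<in> underS W d" using Dg[OF x] unfolding g2_def by blast
        then have "finite (A \<inter> c (idx ?c))" using A(2) unfolding free_of_def by blast
        moreover have "c (idx ?c) = ?c" using idx(2) inv x UF[of d] by blast
        ultimately have "finite (h ` (A \<inter> ?c))" by simp
        moreover have "h ` A \<inter> c x \<subseteq> h ` (A \<inter> ?c)" using AF by auto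
        ultimately show "finite (h ` A \<inter> c x)" using finite_subset by blast
      qed
      ultimately have "d \<in> S1" using d(1) unfolding S1_def by blast
      moreover have "d \<in> closure_points W g1"
        using d(3) unfolding D_def closure_points_def by blast
      ultimately have "d \<in> S2" unfolding S2_def by blast
      moreover have "B d \<subseteq> ?X" using B(1)[OF \<open>d \<in> S1\<close>] d(2) by blast
      then have "\<forall>x\<in>B d. \<forall>y\<in>B d. f x = f y" by auto
      ultimately show ?thesis by blast
    qed
  qed
qed

section \<open>The induction\<close>

lemma ordIso_omega1_iff: "|A| =o omega1 \<longleftrightarrow> |A| \<le>o omega1 \<and> uncountable A"
  by (simp add: ordIso_iff_ordLeq omega1_le_iff_uncountable)

section \<open>Moving families and colourings to the type \<open>'l\<close>\<close>

lemma subset_of_card: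
  assumes r: "Card_order r" and le: "r \<le>o |UNIV :: 'l set|"
  obtains Y :: "'l set" where "|Y| =o r"
proof -
  have "|Field r| \<le>o |UNIV :: 'l set|"
    using card_of_Field_ordIso[OF r] le by (rule ordIso_ordLeq_trans)
  then obtain Y :: "'l set" where Y: "|Field r| =o |Y|"
    using internalize_card_of_ordLeq2[of "Field r" "UNIV :: 'l set"] by blast
  have "|Y| =o r" using ordIso_symmetric[OF Y] card_of_Field_ordIso[OF r] by (rule ordIso_transitive)
  then show thesis by (rule that)
qed

text \<open>The bound on chromatic numbers concerns systems on \<open>'l\<close> of exact size. The
  family is therefore copied into \<open>'l\<close>, enlarged to such a system, and the colouring is
  pulled back along the copying map.\<close>

lemma colouring_of_family:
  fixes \<B> :: "'k set set"
  assumes unc: "natLeq <o |UNIV :: 'l set|"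
    and chi: "\<And>\<B> :: 'l set set. is_system \<B> |UNIV :: 'l set| omega1 natLeq \<Longrightarrow> chi_le \<B> omega1"
    and K: "|K| \<le>o |UNIV :: 'l set|" and \<B>_le: "|\<B>| \<le>o |UNIV :: 'l set|"
    and \<B>: "\<And>B. B \<in> \<B> \<Longrightarrow> B \<subseteq> K \<and> |B| =o omega1"
    and ad: "\<And>B B'. B \<in> \<B> \<Longrightarrow> B' \<in> \<B> \<Longrightarrow> B \<noteq> B' \<Longrightarrow> finite (B \<inter> B')"
  shows "\<exists>f :: 'k \<Rightarrow> 'l set. |f ` K| \<le>o omega1 \<and> (\<forall>B\<in>\<B>. \<exists>x\<in>B. \<exists>y\<in>B. f x \<noteq> f y)"
proof -
  have inf: "infinite (UNIV :: 'l set)"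
    using ordLess_imp_ordLeq[OF unc] infinite_iff_natLeq_ordLeq by blast
  have o1: "omega1 \<le>o |UNIV :: 'l set|"
    using cardSuc_least[OF natLeq_Card_order card_of_Card_order unc] .
  obtain j :: "'k \<Rightarrow> 'l" where j: "inj_on j K"
    using K unfolding card_of_ordLeq[symmetric] by blast
  have "|(UNIV :: 'l set) \<times> (UNIV :: 'l set)| \<le>o |UNIV :: 'l set|"
    using card_of_Times_same_infinite[OF inf] by (rule ordIso_imp_ordLeq)
  then obtain \<pi> :: "'l \<times> 'l \<Rightarrow> 'l" where \<pi>: "inj \<pi>"
    unfolding card_of_ordLeq[symmetric] by auto
  obtain Q0 :: "'l set" where Q0: "|Q0| =o omega1"
    using subset_of_card[OF _ o1] Cinfinite_omega1 by blast
  then obtain q where q: "q \<in> Q0"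
    unfolding ordIso_omega1_iff by (metis all_not_in_conv countable_empty)
  \<comment> \<open>The second coordinate \<open>q\<close> is reserved for copies of points, and the
    coordinates in \<open>Q\<close> for padding, so the two never meet.\<close>
  define Q where "Q = Q0 - {q}"
  have Q: "|Q| \<le>o omega1" "uncountable Q"
  proof -
    have "|Q| \<le>o |Q0|" unfolding Q_def by (rule card_of_mono1) blast
    then show "|Q| \<le>o omega1" using Q0 by (rule ordLeq_ordIso_trans)
    show "uncountable Q" using Q0 unfolding ordIso_omega1_iff Q_def by simp
  qed
  define emb where "emb x = \<pi> (j x, q)" for x
  define D where "D z = \<pi> ` ({z} \<times> Q)" for z
  have emb: "inj_on emb K"
    using j \<pi> unfolding emb_def inj_on_def by blast
  have D_emb: "emb x \<notin> D z" for x z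
    using \<pi> unfolding emb_def D_def Q_def inj_on_def by blast
  have D_disj: "D z \<inter> D z' = {}" if "z \<noteq> z'" for z z'
    using \<pi> that unfolding D_def inj_on_def by blast
  have D_card: "|D z| =o omega1" for z
  proof -
    have D_eq: "D z = (\<lambda>y. \<pi> (z, y)) ` Q" unfolding D_def by auto
    have "inj_on (\<lambda>y. \<pi> (z, y)) Q" using \<pi> unfolding inj_on_def by blast
    then have "uncountable (D z)" using countable_image_inj_on Q(2) unfolding D_eq by blast
    then show ?thesis
      using card_of_image_le[OF Q(1)] unfolding ordIso_omega1_iff D_eq by blast
  qed
  have D_inj: "inj D"
  proof (rule injI, rule ccontr)
    fix z z' assume "D z = D z'" "z \<noteq> z'"
    with D_disj have "D z = {}" by blast
    with D_card[of z] show False unfolding ordIso_omega1_iff by simp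
  qed
  have emb_card: "|emb ` B| =o omega1" if B: "B \<in> \<B>" for B
  proof -
    have "inj_on emb B" using emb by (rule inj_on_subset) (use \<B>[OF B] in blast)
    moreover have "|B| \<le>o omega1" "uncountable B"
      using \<B>[OF B] unfolding ordIso_omega1_iff by auto
    ultimately show ?thesis
      using countable_image_inj_on card_of_image_le unfolding ordIso_omega1_iff by metis
  qed
  have emb_ad: "finite (emb ` B \<inter> emb ` B')" if B: "B \<in> \<B>" "B' \<in> \<B>" "emb ` B \<noteq> emb ` B'" for B B'
  proof -
    have "emb ` B \<inter> emb ` B' = emb ` (B \<inter> B')"
      using inj_on_image_Int[OF emb] \<B>[OF B(1)] \<B>[OF B(2)] by simp
    moreover have "finite (B \<inter> B')" by (rule ad) (use B in auto)
    ultimately show ?thesis by simp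
  qed
  \<comment> \<open>The sets \<open>D z\<close> only pad the family to the exact cardinality demanded by \<open>is_system\<close>.\<close>
  define \<C> where "\<C> = (image emb ` \<B>) \<union> range D"
  have "is_system \<C> |UNIV :: 'l set| omega1 natLeq"
    unfolding is_system_def
  proof (intro conjI ballI impI)
    have "|image emb ` \<B>| \<le>o |UNIV :: 'l set|" using \<B>_le by (rule card_of_image_le)
    moreover have "|range D| \<le>o |UNIV :: 'l set|" by (rule card_of_image)
    ultimately have "|\<C>| \<le>o |UNIV :: 'l set|"
      unfolding \<C>_def by (rule Un_Cinfinite_bound[OF _ _ Cinfinite_card_of[OF inf]])
    moreover have "|UNIV :: 'l set| \<le>o |\<C>|"
      unfolding card_of_ordLeq[symmetric]
      by (rule exI[of _ D]) (use D_inj in \<open>simp add: \<C>_def\<close>)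
    ultimately show "|\<C>| =o |UNIV :: 'l set|" by (simp add: ordIso_iff_ordLeq)
    show "|C| =o omega1" if "C \<in> \<C>" for C
      using that D_card emb_card unfolding \<C>_def by auto
    fix C C' assume C: "C \<in> \<C>" "C' \<in> \<C>" "C \<noteq> C'"
    have "emb ` B \<inter> D z = {}" for B z using D_emb by auto
    then have "finite (C \<inter> C')"
      using C emb_ad D_disj unfolding \<C>_def
      by (elim UnE imageE) (metis Int_commute finite.emptyI)+
    then show "|C \<inter> C'| <o natLeq" by (simp add: finite_iff_ordLess_natLeq)
  qed
  then have "chi_le \<C> omega1" by (rule chi)
  then obtain f :: "'l \<Rightarrow> 'l set" where f: "|f ` \<Union>\<C>| \<le>o omega1" "\<forall>C\<in>\<C>. \<exists>x\<in>C. \<exists>y\<in>C. f x \<noteq> f y"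
    unfolding chi_le_def by (elim exE conjE)
  \<comment> \<open>\<open>chi_le\<close> bounds the colours on the union only, so points outside
    every member get the value \<open>{}\<close>, at the cost of one extra colour.\<close>
  define g where "g x = (if x \<in> \<Union>\<B> then f (emb x) else {})" for x
  have "g ` K \<subseteq> f ` \<Union>\<C> \<union> {{}}"
    unfolding g_def \<C>_def by auto
  moreover have "|f ` \<Union>\<C> \<union> {{}}| \<le>o omega1"
  proof (rule Un_Cinfinite_bound[OF f(1) _ Cinfinite_omega1])
    have "countable {{} :: 'l set}" by simp
    then show "|{{} :: 'l set}| \<le>o omega1"
      unfolding countable_iff_less_omega1 by (rule ordLess_imp_ordLeq)
  qed
  ultimately have "|g ` K| \<le>o omega1" by (rule ordLeq_transitive[OF card_of_mono1])
  moreover have "\<exists>x\<in>B. \<exists>y\<in>B. g x \<noteq> g y" if B: "B \<in> \<B>" for B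
  proof -
    have "emb ` B \<in> \<C>" using B unfolding \<C>_def by blast
    with f(2) have "\<exists>x\<in>emb ` B. \<exists>y\<in>emb ` B. f x \<noteq> f y" by (rule bspec)
    then obtain x y where xy: "x \<in> B" "y \<in> B" "f (emb x) \<noteq> f (emb y)" by auto
    then have "g x \<noteq> g y" using B unfolding g_def by auto
    with xy show ?thesis by blast
  qed
  ultimately show ?thesis by (intro exI[of _ g]) simp
qed

section \<open>Countable subsets of omega1 and of successor cardinals\<close>

lemma ex_countably_infinite_less:
  assumes "natLeq <o |UNIV :: 'l set|"
  obtains M :: "'l set" where "|M| =o natLeq" "infinite M" "|M| <o |UNIV :: 'l set|"
proof -
  obtain M :: "'l set" where M: "|M| =o natLeq"
    using subset_of_card[OF natLeq_Card_order ordLess_imp_ordLeq[OF assms]] by blast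
  then have "infinite M" using infinite_iff_natLeq_ordLeq ordIso_iff_ordLeq by blast
  moreover have "|M| <o |UNIV :: 'l set|" using M assms by (rule ordIso_ordLess_trans)
  ultimately show thesis using that M by blast
qed

text \<open>At a countably infinite set hypothesis (i) yields the continuum hypothesis; it passes to
  \<open>omega1\<close> because countable subsets of \<open>omega1\<close> are bounded.\<close>

lemma csub_le_omega1:
  assumes unc: "natLeq <o |UNIV :: 'l set|" and H: "countable_cof_hyp TYPE('l)"
    and U: "|U| \<le>o omega1"
  shows "|csub U| \<le>o omega1"
proof -
  obtain M :: "'l set" where M: "|M| =o natLeq" "infinite M" "|M| <o |UNIV :: 'l set|"
    using ex_countably_infinite_less[OF unc] by blast
  have "cardSuc |M| =o omega1"
    using M(1) cardSuc_invar_ordIso[OF card_of_Card_order natLeq_Card_order] by blast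
  then have le: "|csub M| \<le>o omega1"
    using csub_le_cardSuc[OF H M(2,3)] ordLeq_ordIso_trans by blast
  have F: "|csub (Field omega1)| \<le>o omega1"
  proof (rule csub_cardSuc_le[OF natLeq_Cinfinite])
    fix a assume "a \<in> Field omega1"
    then have "|underS omega1 a| \<le>o natLeq" by (rule underS_cardSuc_le[OF natLeq_Card_order])
    then have "|underS omega1 a| \<le>o |M|"
      using ordIso_symmetric[OF M(1)] by (rule ordLeq_ordIso_trans)
    then show "|csub (underS omega1 a)| \<le>o omega1"
      using csub_mono le ordLeq_transitive by blast
  qed
  have "omega1 =o |Field omega1|"
    using card_of_Field_ordIso Cinfinite_omega1 ordIso_symmetric by blast
  with U have "|U| \<le>o |Field omega1|" by (rule ordLeq_ordIso_trans)
  from csub_mono[OF this] F show ?thesis by (rule ordLeq_transitive)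
qed

text \<open>Countable subsets are bounded, and a proper initial segment embeds into
  \<open>M\<close>.\<close>

lemma csub_Field_cardSuc_le:
  fixes M :: "'l set"
  assumes H: "countable_cof_hyp TYPE('l)" and M: "infinite M" "|M| <o |UNIV :: 'l set|"
  shows "|csub (Field (cardSuc |M| ))| \<le>o cardSuc |M|"
proof (rule csub_cardSuc_le[OF Cinfinite_card_of[OF M(1)]])
  fix a assume "a \<in> Field (cardSuc |M| )"
  then have "|underS (cardSuc |M| ) a| \<le>o |M|" by (rule underS_cardSuc_le[OF card_of_Card_order])
  from csub_mono[OF this] show "|csub (underS (cardSuc |M| ) a)| \<le>o cardSuc |M|"
    using csub_le_cardSuc[OF H M] ordLeq_transitive by blast
qed

text \<open>Induction on the cardinal of the family, which is why it is only bounded by lambda.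
  Sizes up to \<open>omega1\<close> are direct; above, successors of cardinals of cofinality omega
  are separated from all other cardinals.\<close>

lemma essentially_disjoint_if_le:
  fixes \<A> :: "'b set set"
  assumes unc: "natLeq <o |UNIV :: 'l set|"
    and H: "countable_cof_hyp TYPE('l)"
    and diamond: "\<And>(M :: 'l set) S. natLeq <o |M| \<Longrightarrow> |M| <o |UNIV :: 'l set| \<Longrightarrow>
      has_cof |M| natLeq \<Longrightarrow> S \<subseteq> E_omega1 (cardSuc |M| ) \<Longrightarrow> stationary (cardSuc |M| ) S \<Longrightarrow>
      diamond (cardSuc |M| ) S"
    and chi: "\<And>\<B> :: 'l set set. is_system \<B> |UNIV :: 'l set| omega1 natLeq \<Longrightarrow> chi_le \<B> omega1"
    and "almost_disjoint_family \<A>" "|\<A>| \<le>o |UNIV :: 'l set|"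
  shows "essentially_disjoint \<A> omega1"
  using assms(5,6)
proof (induction \<A> rule: wf_induct_rule[OF wf_inv_image[OF wf_ordLess, of card_of]])
  case (1 \<A>)
  note ad = 1(2) and le = 1(3)
  have IH: "essentially_disjoint \<B> omega1" if "\<B> \<subseteq> \<A>" "|\<B>| <o |\<A>|" for \<B>
  proof (rule 1(1))
    show "(\<B>, \<A>) \<in> inv_image ordLess card_of" using that(2) by (simp add: inv_image_def)
    show "almost_disjoint_family \<B>" by (rule almost_disjoint_family_subset[OF ad that(1)])
    show "|\<B>| \<le>o |UNIV :: 'l set|"
      using ordLess_imp_ordLeq[OF that(2)] le by (rule ordLeq_transitive)
  qed
  have omega1_C: "Card_order omega1" using Cinfinite_omega1 by blast
  have small: "|csub U| \<le>o |M|" if "U \<subseteq> M" "|U| <o |M|" "infinite M" "|M| <o |UNIV :: 'l set|"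
    for U M :: "'l set"
  proof (cases "finite U")
    case True
    then show ?thesis
      using that(3) finite_csub
      by (metis finite_ordLess_infinite card_of_Well_order Field_card_of ordLess_imp_ordLeq)
  next
    case False
    have "|U| <o |UNIV :: 'l set|" using that(2,4) by (rule ordLess_transitive)
    then have "|csub U| \<le>o cardSuc |U|" using csub_le_cardSuc[OF H False] by blast
    moreover have "cardSuc |U| \<le>o |M|"
      using that(2) by (rule cardSuc_least[OF card_of_Card_order card_of_Card_order])
    ultimately show ?thesis by (rule ordLeq_transitive)
  qed
  show ?case
  proof (cases "|\<A>| \<le>o omega1")
    case True
    with ad show ?thesis by (rule essentially_disjoint_if_le_omega1)
  next
    case False
    then have gt: "omega1 <o |\<A>|"
      using not_ordLeq_iff_ordLess[OF Card_order_Well_order[OF omega1_C] card_of_Well_order] by blast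
    have A_unc: "uncountable \<A>"
      using ordLess_imp_ordLeq[OF gt] by (simp add: omega1_le_iff_uncountable)
    show ?thesis
    proof (cases "\<exists>M :: 'l set. omega1 \<le>o |M| \<and> has_cof |M| natLeq \<and> |\<A>| =o cardSuc |M|")
      case True
      then obtain M :: "'l set" where M: "omega1 \<le>o |M|" "has_cof |M| natLeq" "|\<A>| =o cardSuc |M|"
        by blast
      have Minf: "infinite M" using M(1) omega1_le_iff_uncountable countable_finite by blast
      let ?W = "cardSuc |M|"
      have WA: "?W =o |\<A>|" using M(3) by (rule ordIso_symmetric)
      have M_less: "|M| <o |\<A>|"
        using cardSuc_greater[OF card_of_Card_order] WA by (rule ordLess_ordIso_trans)
      then have M_UNIV: "|M| <o |UNIV :: 'l set|" using le by (rule ordLess_ordLeq_trans)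
      have W_UNIV: "?W \<le>o |UNIV :: 'l set|" using WA le by (rule ordIso_ordLeq_trans)
      have FW: "|Field ?W| =o ?W"
        using card_of_Field_ordIso cardSuc_Card_order card_of_Card_order by blast
      have "|csub (Field ?W)| \<le>o |Field ?W|"
        using csub_Field_cardSuc_le[OF H Minf M_UNIV] ordIso_symmetric[OF FW]
        by (rule ordLeq_ordIso_trans)
      moreover have "csub (Field ?W) \<noteq> {}" unfolding csub_def by blast
      ultimately obtain c where c: "c ` Field ?W = csub (Field ?W)"
        using card_of_ordLeq2[of "csub (Field ?W)" "Field ?W"] by blast
      \<comment> \<open>Otherwise diamond would give a family on \<open>Field ?W\<close> with a
        monochromatic member for every colouring in \<open>omega1\<close> colours, against
        \<open>chi\<close>.\<close>
      have "\<not> stationary ?W (bad_points ?W c)"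
      proof
        assume stat: "stationary ?W (bad_points ?W c)"
        have "natLeq <o |M|"
          using cardSuc_greater[OF natLeq_Card_order] M(1) by (rule ordLess_ordLeq_trans)
        then have dia: "diamond ?W (bad_points ?W c)"
          by (rule diamond[OF _ M_UNIV M(2) _ stat]) (simp add: bad_points_def)
        have small1: "|csub U| \<le>o |M|" if "U \<subseteq> Field ?W" "|U| \<le>o omega1" for U
          using csub_le_omega1[OF unc H that(2)] M(1) by (rule ordLeq_transitive)
        show False
        proof (rule monochromatic_if_stationary[OF M(1) small1 c dia])
          fix \<B>
          assume \<B>: "|\<B>| \<le>o ?W" "\<And>B. B \<in> \<B> \<Longrightarrow> B \<subseteq> Field ?W \<and> |B| =o omega1"
            "\<And>B B'. B \<in> \<B> \<Longrightarrow> B' \<in> \<B> \<Longrightarrow> B \<noteq> B' \<Longrightarrow> finite (B \<inter> B')"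
            "\<And>f :: 'l set \<Rightarrow> 'l set. |f ` Field ?W| \<le>o omega1 \<Longrightarrow> \<exists>B\<in>\<B>. \<forall>x\<in>B. \<forall>y\<in>B. f x = f y"
          have "\<exists>f :: 'l set \<Rightarrow> 'l set. |f ` Field ?W| \<le>o omega1 \<and>
            (\<forall>B\<in>\<B>. \<exists>x\<in>B. \<exists>y\<in>B. f x \<noteq> f y)"
          proof (rule colouring_of_family[OF unc chi])
            show "|Field ?W| \<le>o |UNIV :: 'l set|" using FW W_UNIV by (rule ordIso_ordLeq_trans)
            show "|\<B>| \<le>o |UNIV :: 'l set|" using \<B>(1) W_UNIV by (rule ordLeq_transitive)
          qed (use \<B>(2,3) in auto)
          then show False using \<B>(4) by metis
        qed
      qed
      moreover have "essentially_disjoint \<B> omega1" if "\<B> \<subseteq> \<A>" "|\<B>| \<le>o |M|" for \<B>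
        using IH[OF that(1) ordLeq_ordLess_trans[OF that(2) M_less]] .
      ultimately show ?thesis
        using essentially_disjoint_if_not_stationary[OF ad ordIso_imp_ordLeq[OF M(3)] M(1,2)
          small[OF _ _ Minf M_UNIV] c] by blast
    next
      case no: False
      have inf: "infinite \<A>" using A_unc countable_finite by blast
      show ?thesis
      proof (rule essentially_disjoint_if_closed_bounds[OF ad inf _ IH])
        fix X assume X: "X \<subseteq> \<A>" "|X| <o |\<A>|"
        show "\<exists>Z :: 'l set. |X| \<le>o |Z| \<and> |Z| <o |\<A>| \<and> omega1 \<le>o |Z| \<and> |csub Z| \<le>o |Z|"
        proof (cases "|X| \<le>o omega1")
          case True
          have "omega1 \<le>o |UNIV :: 'l set|"
            using ordLess_imp_ordLeq[OF gt] le by (rule ordLeq_transitive)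
          then obtain Z :: "'l set" where Z: "|Z| =o omega1"
            using subset_of_card[OF omega1_C] by blast
          have Z': "omega1 \<le>o |Z|" using ordIso_symmetric[OF Z] by (rule ordIso_imp_ordLeq)
          have "|X| \<le>o |Z|" using True Z' by (rule ordLeq_transitive)
          moreover have "|Z| <o |\<A>|" using Z gt by (rule ordIso_ordLess_trans)
          moreover have "|csub Z| \<le>o |Z|"
            using csub_le_omega1[OF unc H ordIso_imp_ordLeq[OF Z]] Z' by (rule ordLeq_transitive)
          ultimately show ?thesis using Z' by blast
        next
          case False
          have X_UNIV: "|X| <o |UNIV :: 'l set|" using X(2) le by (rule ordLess_ordLeq_trans)
          then obtain Y :: "'l set" where Y: "|Y| =o |X|"
            using subset_of_card[OF card_of_Card_order] ordLess_imp_ordLeq by blast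
          have XY: "|X| \<le>o |Y|" using ordIso_symmetric[OF Y] by (rule ordIso_imp_ordLeq)
          have "omega1 \<le>o |X|"
            using False not_ordLeq_iff_ordLess[OF Card_order_Well_order[OF omega1_C] card_of_Well_order]
              ordLess_imp_ordLeq by blast
          then have Y_ge: "omega1 \<le>o |Y|" using XY by (rule ordLeq_transitive)
          then have Yinf: "infinite Y" using omega1_le_iff_uncountable countable_finite by blast
          have Y_UNIV: "|Y| <o |UNIV :: 'l set|" using Y X_UNIV by (rule ordIso_ordLess_trans)
          have Y_less: "|Y| <o |\<A>|" using Y X(2) by (rule ordIso_ordLess_trans)
          show ?thesis
          proof (cases "has_cof |Y| natLeq")
            case False
            then have "|csub Y| \<le>o |Y|" using csub_le_cardSuc[OF H Yinf Y_UNIV] by blast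
            with XY Y_less Y_ge show ?thesis by blast
          next
            case True
            \<comment> \<open>\<open>Y\<close> has too many countable subsets here, so
              \<open>Z\<close> takes the size of its successor. This is still below the size of
              \<open>\<A>\<close>, because the case \<open>no\<close> excludes equality.\<close>
            let ?r = "cardSuc |Y|"
            have Cr: "Card_order ?r" by (rule cardSuc_Card_order[OF card_of_Card_order])
            have "?r \<le>o |\<A>|"
              using Y_less by (rule cardSuc_least[OF card_of_Card_order card_of_Card_order])
            moreover have "\<not> ?r =o |\<A>|" using no Y_ge True ordIso_symmetric by blast
            ultimately have r_less: "?r <o |\<A>|" using ordLeq_iff_ordLess_or_ordIso by blast
            then have "?r \<le>o |UNIV :: 'l set|" using le ordLess_ordLeq_trans ordLess_imp_ordLeq by blast
            then obtain Z :: "'l set" where Z: "|Z| =o ?r" using subset_of_card[OF Cr] by blast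
            have rZ: "?r \<le>o |Z|" using ordIso_symmetric[OF Z] by (rule ordIso_imp_ordLeq)
            have "|Y| \<le>o ?r" by (rule cardSuc_ordLeq[OF card_of_Card_order])
            then have YZ: "|Y| \<le>o |Z|" using rZ by (rule ordLeq_transitive)
            have "|Z| =o |Field ?r|"
              using Z ordIso_symmetric[OF card_of_Field_ordIso[OF Cr]] by (rule ordIso_transitive)
            then have "|csub Z| \<le>o |csub (Field ?r)|" by (intro csub_mono ordIso_imp_ordLeq)
            then have "|csub Z| \<le>o ?r"
              using csub_Field_cardSuc_le[OF H Yinf Y_UNIV] by (rule ordLeq_transitive)
            then have "|csub Z| \<le>o |Z|" using rZ by (rule ordLeq_transitive)
            moreover have "|X| \<le>o |Z|" using XY YZ by (rule ordLeq_transitive)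
            moreover have "omega1 \<le>o |Z|" using Y_ge YZ by (rule ordLeq_transitive)
            moreover have "|Z| <o |\<A>|" using Z r_less by (rule ordIso_ordLess_trans)
            ultimately show ?thesis by blast
          qed
        qed
      qed
    qed
  qed
qed

theorem theorem9p3:
  fixes \<A> :: "'b set set"
  assumes uncountable: "ordLess2 natLeq (card_of (UNIV :: 'l set))"
    and hyp_i: "\<forall>M :: 'l set. ordLess2 (card_of M) (card_of (UNIV :: 'l set)) \<and>
                  has_cof (card_of M) natLeq \<longrightarrow>
                  ordIso2 (BNF_Cardinal_Arithmetic.cexp (card_of M) natLeq) (cardSuc (card_of M))"
    and hyp_ii: "\<forall>M :: 'l set. ordLess2 natLeq (card_of M) \<and>
                  ordLess2 (card_of M) (card_of (UNIV :: 'l set)) \<and>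
                  has_cof (card_of M) natLeq \<longrightarrow>
                  (\<forall>S. S \<subseteq> E_omega1 (cardSuc (card_of M)) \<and> stationary (cardSuc (card_of M)) S
                       \<longrightarrow> diamond (cardSuc (card_of M)) S)"
    and chi: "\<forall>\<B> :: 'l set set. is_system \<B> (card_of (UNIV :: 'l set)) omega1 natLeq
                \<longrightarrow> chi_le \<B> omega1"
    and sys: "is_system \<A> (card_of (UNIV :: 'l set)) omega1 natLeq"
  shows "essentially_disjoint \<A> omega1"
proof (rule essentially_disjoint_if_le[OF uncountable hyp_i])
  show "almost_disjoint_family \<A>"
    using sys ordIso_imp_ordLeq finite_iff_ordLess_natLeq
    unfolding is_system_def almost_disjoint_family_def by metis
  show "ordLeq3 (card_of \<A>) (card_of (UNIV :: 'l set))"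
    using sys ordIso_imp_ordLeq unfolding is_system_def by blast
qed (use hyp_ii chi in blast)+

end
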